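(* Let $p$ be a prime and let $G$ be $A_n$ or $S_n$ with $n\geq \max\{6,p\}$. Then $G$ has a redundant Sylow $p$-subgroup if and only if $p=2$ and $G=A_n$, where, writing $n=\sum_{i=r}^{k}a_i2^i$ with $a_r,a_{r+1},\dots,a_k\in\{0,1\}$ and $a_r=a_k=1$, the following conditions hold: (1) if $n$ is odd, then $\sum_{i=1}^{k}a_i\equiv 1 \pmod 2$; (2) if $n$ is even, then $r\geq 2$ is even and $\sum_{i=r}^{k}a_i\equiv 1\pmod 2$.
   Context: For a finite group $G$ and a prime $p$, $G_p$ denotes the set of $p$-elements of $G$ and $\mathrm{Syl}_p(G)$ the set of Sylow $p$-subgroups of $G$. $G$ is said to have a redundant Sylow $p$-subgroup if $G_p$ is contained in the union of the members of some proper subset of $\mathrm{Syl}_p(G)$. *)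

theory Defs
  imports "HOL-Algebra.Algebra" "HOL-Algebra.Sym_Groups" "HOL-Algebra.Multiplicative_Group"
    "HOL-Computational_Algebra.Primes"
begin

definition p_elements :: "('a, 'b) monoid_scheme \<Rightarrow> nat \<Rightarrow> 'a set" where
  "p_elements G p = {x \<in> carrier G. \<exists>k::nat. group.ord G x = p ^ k}"

definition Sylow_subgroups :: "('a, 'b) monoid_scheme \<Rightarrow> nat \<Rightarrow> 'a set set" where
  "Sylow_subgroups G p =
     {P. subgroup P G \<and> card P = p ^ multiplicity p (order G)}"

definition has_redundant_Sylow :: "('a, 'b) monoid_scheme \<Rightarrow> nat \<Rightarrow> bool" where
  "has_redundant_Sylow G p \<longleftrightarrow>
     (\<exists>S. S \<subset> Sylow_subgroups G p \<and> p_elements G p \<subseteq> \<Union>S)"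

definition bin_digit :: "nat \<Rightarrow> nat \<Rightarrow> nat" where
  "bin_digit n i = n div 2 ^ i mod 2"

definition bin_low :: "nat \<Rightarrow> nat" where
  "bin_low n = Min {i. bin_digit n i = 1}"

definition bin_high :: "nat \<Rightarrow> nat" where
  "bin_high n = Max {i. bin_digit n i = 1}"

definition alt_redundant_cond :: "nat \<Rightarrow> bool" where
  "alt_redundant_cond n \<longleftrightarrow>
     (odd n \<longrightarrow> odd (\<Sum>i\<in>{1..bin_high n}. bin_digit n i)) \<and>
     (even n \<longrightarrow> bin_low n \<ge> 2 \<and> even (bin_low n) \<and>
                 odd (\<Sum>i\<in>{bin_low n..bin_high n}. bin_digit n i))"

end

theory Submission
  imports Defs
begin

text \<open>
  By Sylow conjugacy, \<open>G\<close> has a redundant Sylow \<open>p\<close>-subgroup iff no \<open>p\<close>-element lies in exactly one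
  Sylow \<open>p\<close>-subgroup; an element of a subgroup \<open>A\<close> lying in a single Sylow subgroup of \<open>G\<close> lies in a
  single one of \<open>A\<close>.

  Every \<open>p\<close>-group of permutations of a set \<open>S\<close> centralizes some \<open>z\<close> with \<open>z\<^sup>p = 1\<close> that has fewer than \<open>p\<close>
  fixed points, and acts on the set of nontrivial cycles of \<open>z\<close>; iterating, the Sylow subgroups of the
  symmetric group are described by towers of such permutations. If \<open>x\<close> has fewer than \<open>p\<close> cycles of
  each length (for \<open>p = 2\<close> two fixed points are also allowed), commuting with \<open>x\<close> determines the
  cycles of \<open>z\<close>, and the property passes to the action of \<open>x\<close> on them, so \<open>x\<close> lies in a unique Sylow
  subgroup. The base \<open>p\<close> digits of \<open>n\<close> give such an \<open>x\<close>, which settles everything except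
  \<open>p = 2\<close> and the alternating group. There the number of cycles, hence the parity, of \<open>x\<close> is read off from
  the binary digits of \<open>n\<close> or (two fixed points) of \<open>n - 1\<close>.

  Conversely, if \<open>x\<close> is an even \<open>2\<close>-element with three fixed points or with two cycles of equal length
  \<open>m > 1\<close>, there are even \<open>t\<close> and \<open>u\<close>, each generating a \<open>2\<close>-group together with \<open>x\<close>, such that \<open>t u\<close> has
  order \<open>3\<close>; hence \<open>x\<close> lies in two Sylow subgroups of the alternating group.
\<close>

section \<open>Sylow theory\<close>

text \<open>Towers stand in for iterated wreath products: one permutation \<open>z\<close> per level
  is recorded, and no block systems or product decompositions are carried along. For odd
  \<open>p\<close> the obstacle is that \<open>x\<close> does not determine \<open>z\<close>: on
  each cycle of \<open>x\<close> it may be replaced by a power with exponent prime to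
  \<open>p\<close>. Hence levels are compared through the cycles of \<open>z\<close>, and through
  the fact that the tower group preserves the cycles of \<open>x\<close>. The exception of two fixed
  points at \<open>p = 2\<close> comes from \<open>z\<close> having at most one fixed point: it has
  to swap them. In the action on the cycles of \<open>z\<close> the pair becomes a single point, so
  the same exception suffices at every level. Passing from an even \<open>n\<close> to
  \<open>n - 1\<close> turns the final digits 1 0...0 into 0 1...1, and this is how
  \<open>bin_low n\<close> enters a parity condition. The bound 6 is used for two 2-cycles: they
  occupy four points, \<open>t\<close> is then odd, and two further points must carry the correcting
  transposition.\<close>

lemma p_group_fixed_points:
  fixes G (structure) and act :: "'a \<Rightarrow> 'b \<Rightarrow> 'b"
  assumes G: "group G" and p: "Factorial_Ring.prime p" and cG: "card (carrier G) = p ^ k"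
    and finE: "finite E"
    and closed: "\<And>g x. g \<in> carrier G \<Longrightarrow> x \<in> E \<Longrightarrow> act g x \<in> E"
    and act_one: "\<And>x. x \<in> E \<Longrightarrow> act \<one> x = x"
    and act_mult: "\<And>g h x. g \<in> carrier G \<Longrightarrow> h \<in> carrier G \<Longrightarrow> x \<in> E \<Longrightarrow> act (g \<otimes> h) x = act g (act h x)"
  shows "card E mod p = card {x \<in> E. \<forall>g\<in>carrier G. act g x = x} mod p"
proof -
  interpret group G by fact
  have finG: "finite (carrier G)"
    using cG p by (intro card_ge_0_finite) (simp add: prime_gt_0_nat)
  define orb where "orb x = (\<lambda>g. act g x) ` carrier G" for x
  define F where "F = {x \<in> E. \<forall>g\<in>carrier G. act g x = x}"
  have self: "x \<in> orb x" if "x \<in> E" for x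
    using act_one[OF that] unfolding orb_def by (metis imageI one_closed)
  have orb_eq: "orb y = orb x" if x: "x \<in> E" and y: "y \<in> orb x" for x y
  proof -
    obtain h where h: "h \<in> carrier G" "y = act h x" using y unfolding orb_def by blast
    have xy: "act (inv h) y = x"
      using h x act_mult[of "inv h" h x] act_one by simp
    show ?thesis
    proof
      show "orb y \<subseteq> orb x"
        unfolding orb_def h(2) using h x by (auto simp: act_mult[symmetric])
      show "orb x \<subseteq> orb y"
      proof
        fix w assume "w \<in> orb x"
        then obtain g where g: "g \<in> carrier G" "w = act g x" unfolding orb_def by blast
        have "w = act (g \<otimes> inv h) y"
          using act_mult[of g "inv h" y] g h(1) closed[OF h(1) x] by (simp add: xy h(2)[symmetric])
        thus "w \<in> orb y" unfolding orb_def using g h by blast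
      qed
    qed
  qed
  have orb_sub: "orb x \<subseteq> E" if "x \<in> E" for x
    using that closed unfolding orb_def by blast
  have card_orb: "card (orb x) dvd p ^ k" if x: "x \<in> E" for x
  proof -
    define St where "St = {g \<in> carrier G. act g x = x}"
    \<comment> \<open>Orbit-stabilizer by counting: left translation by \<open>h\<close> maps the
      stabilizer onto the fibre over \<open>act h x\<close>.\<close>
    have fib: "card {g \<in> carrier G. act g x = y} = card St" if y: "y \<in> orb x" for y
    proof -
      obtain h where h: "h \<in> carrier G" "y = act h x" using y unfolding orb_def by blast
      have "bij_betw (\<lambda>g. h \<otimes> g) St {g \<in> carrier G. act g x = y}"
      proof (rule bij_betwI[where g = "\<lambda>g. inv h \<otimes> g"])
        show "(\<otimes>) h \<in> St \<rightarrow> {g \<in> carrier G. act g x = y}"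
          using h x unfolding St_def by (auto simp: act_mult)
        show "(\<otimes>) (inv h) \<in> {g \<in> carrier G. act g x = y} \<rightarrow> St"
          using h x act_mult[of "inv h" h x] act_one unfolding St_def by (auto simp: act_mult)
      qed (use h in \<open>auto simp: St_def m_assoc[symmetric]\<close>)
      thus ?thesis by (metis bij_betw_same_card)
    qed
    have "card (carrier G) = (\<Sum>y\<in>orb x. card {g \<in> carrier G. act g x = y})"
      using sum.image_gen[OF finG, of "\<lambda>_. 1::nat" "\<lambda>g. act g x"] unfolding orb_def by simp
    also have "\<dots> = card (orb x) * card St" using fib by simp
    finally show ?thesis using cG by (metis dvd_triv_left)
  qed
  have big: "p dvd card (orb x)" if x: "x \<in> E - F" for x
  proof -
    have "card (orb x) \<noteq> 1"
    proof
      assume "card (orb x) = 1"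
      then obtain w where "orb x = {w}" by (rule card_1_singletonE)
      hence "orb x = {x}" using self[of x] x by auto
      hence "x \<in> F" using x unfolding F_def orb_def by auto
      thus False using x by auto
    qed
    moreover obtain j where "card (orb x) = p ^ j"
      using card_orb x p by (auto simp: divides_primepow_nat)
    ultimately show ?thesis by (cases j) auto
  qed
  have FX: "F \<subseteq> E" unfolding F_def by blast
  have "p dvd card (\<Union>x\<in>E - F. orb x)"
  proof -
    have "disjoint (orb ` (E - F))"
    proof (unfold pairwise_def disjnt_def, intro ballI impI)
      fix A B assume "A \<in> orb ` (E - F)" "B \<in> orb ` (E - F)" "A \<noteq> B"
      then obtain a b where "A = orb a" "B = orb b" "a \<in> E" "b \<in> E" by blast
      thus "A \<inter> B = {}" using orb_eq \<open>A \<noteq> B\<close> by blast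
    qed
    moreover have "\<And>A. A \<in> orb ` (E - F) \<Longrightarrow> finite A" using orb_sub finE finite_subset by blast
    ultimately have "card (\<Union> (orb ` (E - F))) = sum card (orb ` (E - F))"
      by (rule card_Union_disjoint)
    thus ?thesis using big by (auto intro!: dvd_sum)
  qed
  moreover have "(\<Union>x\<in>E - F. orb x) = E - F"
  proof
    show "E - F \<subseteq> (\<Union>x\<in>E - F. orb x)" using self by blast
    show "(\<Union>x\<in>E - F. orb x) \<subseteq> E - F"
    proof
      fix y assume "y \<in> (\<Union>x\<in>E - F. orb x)"
      then obtain x where x: "x \<in> E" "x \<notin> F" "y \<in> orb x" by blast
      have yX: "y \<in> E" using x orb_sub by blast
      moreover have "y \<notin> F"
      proof
        assume yF: "y \<in> F"
        hence "orb y \<subseteq> {y}" unfolding F_def orb_def by auto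
        hence "x = y" using orb_eq[OF x(1,3)] self[OF x(1)] by auto
        thus False using x yF by simp
      qed
      ultimately show "y \<in> E - F" by blast
    qed
  qed
  moreover have "card E = card (E - F) + card F"
    using FX finE by (metis add.commute card_Diff_subset card_mono finite_subset le_add_diff_inverse)
  ultimately have "card E mod p = card F mod p" by (metis dvd_eq_mod_eq_0 mod_add_self1 mod_add_left_eq add_0)
  thus ?thesis unfolding F_def .
qed

context group
begin

lemma ord_prime_power_iff:
  assumes "Factorial_Ring.prime p" "x \<in> carrier G"
  shows "(\<exists>k. ord x = p ^ k) \<longleftrightarrow> (\<exists>k. x [^] (p ^ k :: nat) = \<one>)"
  using assms by (auto simp: pow_eq_id divides_primepow_nat)

text \<open>By Cauchy's theorem (\<open>sylow_thm\<close> with exponent 1) another prime divisor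
  \<open>q\<close> of the order would give a subgroup of order \<open>q\<close>, and a nontrivial
  element of it would have an order dividing both \<open>q\<close> and a power of
  \<open>p\<close>.\<close>

lemma card_p_subgroup:
  assumes p: "Factorial_Ring.prime p" and fin: "finite (carrier G)" and H: "subgroup H G"
    and el: "\<And>h. h \<in> H \<Longrightarrow> \<exists>k. h [^] (p ^ k :: nat) = \<one>"
  shows "\<exists>k. card H = p ^ k"
proof (rule ccontr)
  assume neg: "\<nexists>k. card H = p ^ k"
  interpret H: group "G\<lparr>carrier := H\<rparr>" using H by (rule subgroup_imp_group)
  have HG: "H \<subseteq> carrier G" using H by (rule subgroup.subset)
  have finH: "finite H" using HG fin finite_subset by blast
  have "card H \<noteq> 0" using finH subgroup.one_closed[OF H] by auto
  obtain q where q: "Factorial_Ring.prime q" "q dvd card H" "q \<noteq> p"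
  proof (rule ccontr)
    assume "\<not> thesis"
    hence "\<And>q. Factorial_Ring.prime q \<Longrightarrow> q dvd card H \<Longrightarrow> q = p" using that by blast
    hence "prime_factors (card H) \<subseteq> {p}" by (auto simp: prime_factors_dvd)
    hence "prime_factors (card H) = {} \<or> prime_factors (card H) = {p}" by blast
    hence "card H = p ^ 0 \<or> card H = p ^ multiplicity p (card H)"
      using prime_factorization_nat[of "card H"] \<open>card H \<noteq> 0\<close> by auto
    thus False using neg by blast
  qed
  have "\<exists>K. subgroup K (G\<lparr>carrier := H\<rparr>) \<and> card K = q ^ 1"
    using q finH by (intro sylow_thm[of q _ 1 "card H div q"] H.is_group) (auto simp: order_def)
  then obtain K where K: "subgroup K (G\<lparr>carrier := H\<rparr>)" "card K = q" by auto
  have KH: "K \<subseteq> H" using subgroup.subset[OF K(1)] by simp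
  have KG: "subgroup K G" using incl_subgroup[OF H K(1)] .
  interpret K: group "G\<lparr>carrier := K\<rparr>" using KG by (rule subgroup_imp_group)
  have "K \<noteq> {\<one>}" using K(2) q(1) by auto
  then obtain h where h: "h \<in> K" "h \<noteq> \<one>" using subgroup.one_closed[OF KG] by blast
  have hG: "h \<in> carrier G" using h KH HG by blast
  have "h [^]\<^bsub>G\<lparr>carrier := K\<rparr>\<^esub> order (G\<lparr>carrier := K\<rparr>) = \<one>"
    using K.pow_order_eq_1[of h] h by simp
  hence "h [^] q = \<one>" using K(2) by (simp add: order_def nat_pow_def)
  hence "ord h dvd q" using hG pow_eq_id by blast
  moreover obtain k where "ord h dvd p ^ k" using el[of h] h KH hG pow_eq_id by blast
  moreover have "coprime q (p ^ k)" using q p by (simp add: primes_coprime)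
  ultimately have "ord h = 1" by (metis coprime_common_divisor_nat nat_dvd_1_iff_1 One_nat_def)
  thus False using h hG ord_eq_1 by auto
qed

lemma p_power_pow_eq_one:
  assumes "subgroup H G" "card H = p ^ k" "h \<in> H"
  shows "h [^] (p ^ k :: nat) = \<one>"
proof -
  interpret H: group "G\<lparr>carrier := H\<rparr>" using assms(1) by (rule subgroup_imp_group)
  have "h [^]\<^bsub>G\<lparr>carrier := H\<rparr>\<^esub> order (G\<lparr>carrier := H\<rparr>) = \<one>"
    using H.pow_order_eq_1[of h] assms by simp
  thus ?thesis using assms by (simp add: order_def nat_pow_def)
qed

text \<open>For conjugation the fixed points form the centre, whose order is therefore divisible by
  \<open>p\<close>; a suitable power of a nontrivial central element has order exactly
  \<open>p\<close>.\<close>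

lemma p_group_central_element:
  assumes p: "Factorial_Ring.prime p" and cG: "card (carrier G) = p ^ k" and nt: "carrier G \<noteq> {\<one>}"
  shows "\<exists>c\<in>carrier G. c \<noteq> \<one> \<and> c [^] p = \<one> \<and> (\<forall>g\<in>carrier G. g \<otimes> c = c \<otimes> g)"
proof -
  have fin: "finite (carrier G)"
    using cG p by (intro card_ge_0_finite) (simp add: prime_gt_0_nat)
  define act where "act g x = g \<otimes> x \<otimes> inv g" for g x
  define Z where "Z = {x \<in> carrier G. \<forall>g\<in>carrier G. act g x = x}"
  have "card (carrier G) mod p = card Z mod p"
    unfolding Z_def
    by (rule p_group_fixed_points[OF is_group p cG fin])
      (auto simp: act_def m_assoc inv_mult_group)
  moreover have "k \<noteq> 0"
  proof
    assume "k = 0"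
    hence "card (carrier G) = 1" using cG by simp
    thus False using nt one_closed by (metis card_1_singletonE singletonD)
  qed
  ultimately have pZ: "p dvd card Z" using cG by (metis dvd_power mod_0_imp_dvd dvd_imp_mod_0 neq0_conv)
  have oneZ: "\<one> \<in> Z" unfolding Z_def act_def by auto
  have "Z \<noteq> {\<one>}" using pZ p by auto
  then obtain c where c: "c \<in> Z" "c \<noteq> \<one>" using oneZ by blast
  have cc: "c \<in> carrier G" using c unfolding Z_def by auto
  have comm: "g \<otimes> c = c \<otimes> g" if "g \<in> carrier G" for g
  proof -
    have "g \<otimes> c \<otimes> inv g = c" using c that unfolding Z_def act_def by auto
    thus ?thesis using that cc by (metis inv_solve_right m_closed)
  qed
  have "ord c dvd p ^ k" using cc cG ord_dvd_group_order unfolding order_def by metis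
  then obtain j where j: "ord c = p ^ j" using p by (auto simp: divides_primepow_nat)
  have "j \<noteq> 0" using j c cc ord_eq_1 by (metis power_0)
  then obtain i where i: "j = Suc i" by (cases j) auto
  have "c [^] (p ^ i) \<noteq> \<one>"
  proof
    assume "c [^] (p ^ i) = \<one>"
    hence "p ^ Suc i dvd p ^ i" using j i cc pow_eq_id by metis
    thus False using p by (simp add: prime_gt_1_nat dvd_power_iff_le prime_ge_2_nat)
  qed
  moreover have "(c [^] (p ^ i)) [^] p = \<one>"
    using cc j i by (metis nat_pow_pow pow_ord_eq_1 power_Suc2)
  moreover have "g \<otimes> c [^] (p ^ i) = c [^] (p ^ i) \<otimes> g" if "g \<in> carrier G" for g
  proof -
    have "g \<otimes> c [^] m = c [^] m \<otimes> g" for m :: nat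
    proof (induction m)
      case (Suc m)
      have "g \<otimes> (c [^] m \<otimes> c) = c [^] m \<otimes> g \<otimes> c"
        using Suc that cc by (simp add: m_assoc[symmetric])
      also have "\<dots> = c [^] m \<otimes> c \<otimes> g" using that cc comm[OF that] by (simp add: m_assoc)
      finally show ?case by simp
    qed (use that in simp)
    thus ?thesis .
  qed
  ultimately show ?thesis using cc by blast
qed

end

section \<open>Existence, conjugacy and maximality of Sylow subgroups\<close>

locale finite_group_prime = group +
  fixes p :: nat
  assumes prime_p: "Factorial_Ring.prime p" and finite_carrier: "finite (carrier G)"
begin

lemma order_pos: "order G > 0"
  using finite_carrier by (simp add: order_gt_0_iff_finite)

lemma Sylow_exists: "\<exists>P. P \<in> Sylow_subgroups G p"
proof -
  have "order G = p ^ multiplicity p (order G) * (order G div p ^ multiplicity p (order G))"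
    by (simp add: multiplicity_dvd)
  from sylow_thm[OF prime_p is_group this finite_carrier] show ?thesis
    unfolding Sylow_subgroups_def by blast
qed

text \<open>\<open>P\<close> acts on the cosets of \<open>Q\<close>, whose number is prime to
  \<open>p\<close>, so some coset \<open>Q #> a\<close> is fixed, which means that \<open>a\<close>
  conjugates \<open>P\<close> into \<open>Q\<close>.\<close>

lemma p_subgroup_conjugate_into_Sylow:
  assumes P: "subgroup P G" "card P = p ^ k" and Q: "Q \<in> Sylow_subgroups G p"
  shows "\<exists>g\<in>carrier G. \<forall>h\<in>P. inv g \<otimes> h \<otimes> g \<in> Q"
proof -
  have Qs: "subgroup Q G" and cQ: "card Q = p ^ multiplicity p (order G)"
    using Q unfolding Sylow_subgroups_def by auto
  interpret P: group "G\<lparr>carrier := P\<rparr>" using P(1) by (rule subgroup_imp_group)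
  have PG: "P \<subseteq> carrier G" and QG: "Q \<subseteq> carrier G" using P Qs subgroup.subset by blast+
  define E where "E = rcosets Q"
  \<comment> \<open>The inverse turns right multiplication of cosets into a left action.\<close>
  define act where "act g C = C #> inv g" for g C
  have XG: "C \<subseteq> carrier G" if "C \<in> E" for C
    using that QG unfolding E_def RCOSETS_def r_coset_def by auto
  have fX: "finite E"
    using XG finite_carrier by (metis PowI finite_Pow_iff finite_subset subsetI)
  have "card E mod p = card {C \<in> E. \<forall>g\<in>carrier (G\<lparr>carrier := P\<rparr>). act g C = C} mod p"
  proof (rule p_group_fixed_points[OF P.is_group prime_p])
    show "card (carrier (G\<lparr>carrier := P\<rparr>)) = p ^ k" using P by simp
    fix g C assume g: "g \<in> carrier (G\<lparr>carrier := P\<rparr>)" and C: "C \<in> E"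
    obtain a where a: "a \<in> carrier G" "C = Q #> a" using C unfolding E_def RCOSETS_def by auto
    have "act g C = Q #> (a \<otimes> inv g)"
      unfolding act_def a(2) using g a PG QG by (intro coset_mult_assoc) auto
    moreover have "a \<otimes> inv g \<in> carrier G" using a g PG by auto
    ultimately show "act g C \<in> E" unfolding E_def RCOSETS_def by blast
  next
    fix C assume C: "C \<in> E"
    show "act \<one>\<^bsub>G\<lparr>carrier := P\<rparr>\<^esub> C = C" unfolding act_def using XG[OF C] by simp
  next
    fix g h C assume "g \<in> carrier (G\<lparr>carrier := P\<rparr>)" "h \<in> carrier (G\<lparr>carrier := P\<rparr>)" "C \<in> E"
    thus "act (g \<otimes>\<^bsub>G\<lparr>carrier := P\<rparr>\<^esub> h) C = act g (act h C)"
      unfolding act_def using XG[of C] PG by (auto simp: coset_mult_assoc inv_mult_group subset_iff)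
  qed (fact fX)
  moreover have "\<not> p dvd card E"
  proof
    assume "p dvd card E"
    hence "p ^ multiplicity p (order G) * p dvd order G"
      using lagrange[OF Qs] cQ unfolding E_def by (metis dvd_refl mult.commute mult_dvd_mono)
    hence "p ^ Suc (multiplicity p (order G)) dvd order G" by (simp add: mult.commute)
    thus False using order_pos prime_p
      by (metis Suc_n_not_le_n neq0_conv multiplicity_geI not_prime_unit)
  qed
  ultimately have "card {C \<in> E. \<forall>g\<in>P. act g C = C} \<noteq> 0"
    by (intro notI) (simp add: dvd_eq_mod_eq_0)
  then obtain C where C: "C \<in> E" "\<And>g. g \<in> P \<Longrightarrow> act g C = C"
    by (metis (mono_tags, lifting) card.empty empty_Collect_eq)
  obtain a where a: "a \<in> carrier G" "C = Q #> a" using C unfolding E_def RCOSETS_def by auto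
  have "a \<otimes> h \<otimes> inv a \<in> Q" if h: "h \<in> P" for h
  proof -
    have hG: "h \<in> carrier G" using h PG by blast
    have "inv h \<in> P" using h P(1) by (simp add: subgroup.m_inv_closed)
    hence "Q #> a #> h = Q #> a" using C(2)[of "inv h"] a hG unfolding act_def by simp
    hence "Q #> (a \<otimes> h) = Q #> a" using a hG QG by (simp add: coset_mult_assoc)
    hence "a \<otimes> h \<in> Q #> a" using rcos_self[OF _ Qs, of "a \<otimes> h"] a hG by auto
    then obtain q where "q \<in> Q" "a \<otimes> h = q \<otimes> a" unfolding r_coset_def by auto
    thus ?thesis using a hG QG by (metis inv_solve_right m_closed subsetD)
  qed
  thus ?thesis using a by (intro bexI[of _ "inv a"]) auto
qed

lemma conjugate_Sylow:
  assumes Q: "Q \<in> Sylow_subgroups G p" and g: "g \<in> carrier G"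
  shows "(\<lambda>q. g \<otimes> q \<otimes> inv g) ` Q \<in> Sylow_subgroups G p"
proof -
  have Qs: "subgroup Q G" and cQ: "card Q = p ^ multiplicity p (order G)"
    using Q unfolding Sylow_subgroups_def by auto
  have QG: "Q \<subseteq> carrier G" using Qs subgroup.subset by blast
  have "subgroup ((\<lambda>q. g \<otimes> q \<otimes> inv g) ` Q) G"
  proof (rule subgroupI)
    fix a b assume "a \<in> (\<lambda>q. g \<otimes> q \<otimes> inv g) ` Q" "b \<in> (\<lambda>q. g \<otimes> q \<otimes> inv g) ` Q"
    then obtain x y where xy: "x \<in> Q" "y \<in> Q" "a = g \<otimes> x \<otimes> inv g" "b = g \<otimes> y \<otimes> inv g" by blast
    have G: "x \<in> carrier G" "y \<in> carrier G" using xy QG by auto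
    have "inv g \<otimes> (g \<otimes> (y \<otimes> inv g)) = y \<otimes> inv g"
      using g G by (simp add: m_assoc[symmetric])
    hence "a \<otimes> b = g \<otimes> (x \<otimes> y) \<otimes> inv g"
      unfolding xy using g G by (simp add: m_assoc)
    thus "a \<otimes> b \<in> (\<lambda>q. g \<otimes> q \<otimes> inv g) ` Q" using xy subgroup.m_closed[OF Qs] by blast
    have "inv a = g \<otimes> inv x \<otimes> inv g" unfolding xy using g G by (simp add: inv_mult_group m_assoc)
    thus "inv a \<in> (\<lambda>q. g \<otimes> q \<otimes> inv g) ` Q" using xy subgroup.m_inv_closed[OF Qs] by blast
  qed (use g QG Qs subgroup.one_closed in \<open>auto\<close>)
  moreover have "inj_on (\<lambda>q. g \<otimes> q \<otimes> inv g) Q"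
    using g QG by (intro inj_onI) (metis inv_closed m_closed r_cancel subsetD l_cancel)
  ultimately show ?thesis unfolding Sylow_subgroups_def using cQ by (simp add: card_image)
qed

lemma p_subgroup_in_Sylow:
  assumes P: "subgroup P G" "card P = p ^ k"
  shows "\<exists>Q\<in>Sylow_subgroups G p. P \<subseteq> Q"
proof -
  obtain Q where Q: "Q \<in> Sylow_subgroups G p" using Sylow_exists by blast
  obtain g where g: "g \<in> carrier G" "\<And>h. h \<in> P \<Longrightarrow> inv g \<otimes> h \<otimes> g \<in> Q"
    using p_subgroup_conjugate_into_Sylow[OF P Q] by blast
  have "P \<subseteq> (\<lambda>q. g \<otimes> q \<otimes> inv g) ` Q"
  proof
    fix h assume h: "h \<in> P"
    hence "h \<in> carrier G" using P subgroup.subset by blast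
    hence "h = g \<otimes> (inv g \<otimes> h \<otimes> g) \<otimes> inv g" using g by (simp add: m_assoc) (simp add: m_assoc[symmetric])
    thus "h \<in> (\<lambda>q. g \<otimes> q \<otimes> inv g) ` Q" using g(2)[OF h] by blast
  qed
  thus ?thesis using conjugate_Sylow[OF Q g(1)] by blast
qed

lemma Sylow_maximal:
  assumes P: "P \<in> Sylow_subgroups G p" and W: "subgroup W G" "card W = p ^ k" and PW: "P \<subseteq> W"
  shows "P = W"
proof -
  have finW: "finite W" using W(1) finite_carrier subgroup.subset finite_subset by blast
  have "p ^ k dvd order G" using W lagrange[OF W(1)] by (metis dvd_triv_right)
  hence "k \<le> multiplicity p (order G)"
    using order_pos prime_p by (metis multiplicity_geI neq0_conv not_prime_unit)
  hence "card W \<le> card P"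
    using W P prime_p unfolding Sylow_subgroups_def
    by (auto intro!: power_increasing simp: prime_ge_Suc_0_nat)
  thus ?thesis using finW PW by (simp add: card_seteq)
qed

lemma Sylow_conjugate:
  assumes P: "P \<in> Sylow_subgroups G p" and Q: "Q \<in> Sylow_subgroups G p"
  shows "\<exists>g\<in>carrier G. P = (\<lambda>q. g \<otimes> q \<otimes> inv g) ` Q"
proof -
  have Ps: "subgroup P G" and cP: "card P = p ^ multiplicity p (order G)"
    using P unfolding Sylow_subgroups_def by auto
  obtain g where g: "g \<in> carrier G" "\<And>h. h \<in> P \<Longrightarrow> inv g \<otimes> h \<otimes> g \<in> Q"
    using p_subgroup_conjugate_into_Sylow[OF Ps cP Q] by blast
  have "P \<subseteq> (\<lambda>q. g \<otimes> q \<otimes> inv g) ` Q"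
  proof
    fix h assume h: "h \<in> P"
    hence "h \<in> carrier G" using Ps subgroup.subset by blast
    hence "h = g \<otimes> (inv g \<otimes> h \<otimes> g) \<otimes> inv g" using g by (simp add: m_assoc) (simp add: m_assoc[symmetric])
    thus "h \<in> (\<lambda>q. g \<otimes> q \<otimes> inv g) ` Q" using g(2)[OF h] by blast
  qed
  moreover have S: "(\<lambda>q. g \<otimes> q \<otimes> inv g) ` Q \<in> Sylow_subgroups G p" using conjugate_Sylow[OF Q g(1)] .
  ultimately have "P = (\<lambda>q. g \<otimes> q \<otimes> inv g) ` Q"
    using Sylow_maximal[OF P] unfolding Sylow_subgroups_def by blast
  thus ?thesis using g by blast
qed

section \<open>Redundancy and elements lying in a single Sylow subgroup\<close>

lemma mem_p_elements_iff:
  "x \<in> p_elements G p \<longleftrightarrow> x \<in> carrier G \<and> (\<exists>k. x [^] (p ^ k :: nat) = \<one>)"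
  unfolding p_elements_def using ord_prime_power_iff[OF prime_p] by blast

lemma Sylow_element_p_power:
  assumes "P \<in> Sylow_subgroups G p" "x \<in> P"
  shows "\<exists>k. x [^] (p ^ k :: nat) = \<one>"
  using assms p_power_pow_eq_one unfolding Sylow_subgroups_def by blast

text \<open>Let \<open>S\<close> omit \<open>R\<close> and let \<open>P\<close> in \<open>S\<close>
  contain \<open>x\<close>. Conjugating \<open>P\<close> to \<open>R\<close> moves \<open>x\<close>
  to a \<open>p\<close>-element of \<open>R\<close>; a member of \<open>S\<close> containing that
  element must be \<open>R\<close> itself, by uniqueness for \<open>x\<close> transported along the
  same conjugation.\<close>

lemma not_redundant_if_unique:
  assumes x: "x \<in> p_elements G p"
    and uniq: "\<And>P Q. P \<in> Sylow_subgroups G p \<Longrightarrow> Q \<in> Sylow_subgroups G p \<Longrightarrow> x \<in> P \<Longrightarrow> x \<in> Q \<Longrightarrow> P = Q"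
  shows "\<not> has_redundant_Sylow G p"
proof
  assume "has_redundant_Sylow G p"
  then obtain S where S: "S \<subset> Sylow_subgroups G p" "p_elements G p \<subseteq> \<Union>S"
    unfolding has_redundant_Sylow_def by blast
  then obtain R where R: "R \<in> Sylow_subgroups G p" "R \<notin> S" by blast
  obtain P where P: "P \<in> S" "x \<in> P" using S x by blast
  obtain g where g: "g \<in> carrier G" "R = (\<lambda>q. g \<otimes> q \<otimes> inv g) ` P"
    using Sylow_conjugate[OF R(1), of P] P S by blast
  have xG: "x \<in> carrier G" using x by (simp add: mem_p_elements_iff)
  let ?y = "g \<otimes> x \<otimes> inv g"
  have yR: "?y \<in> R" using g P by blast
  have "?y \<in> p_elements G p"
    using Sylow_element_p_power[OF R(1) yR] g xG by (simp add: mem_p_elements_iff)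
  then obtain T where T: "T \<in> S" "?y \<in> T" using S by blast
  have TS: "T \<in> Sylow_subgroups G p" using T S by blast
  have inv_g: "inv g \<in> carrier G" using g by simp
  let ?T = "(\<lambda>q. inv g \<otimes> q \<otimes> inv (inv g)) ` T"
  have "x = inv g \<otimes> ?y \<otimes> inv (inv g)" using g xG by (simp add: m_assoc) (simp add: m_assoc[symmetric])
  hence "x \<in> ?T" using T by blast
  hence "?T = P" using uniq[OF conjugate_Sylow[OF TS inv_g], of P] P S by blast
  moreover have "(\<lambda>q. g \<otimes> q \<otimes> inv g) ` ?T = T"
  proof -
    have "g \<otimes> (inv g \<otimes> q \<otimes> inv (inv g)) \<otimes> inv g = q" if "q \<in> T" for q
    proof -
      have "q \<in> carrier G" using that TS subgroup.subset unfolding Sylow_subgroups_def by blast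
      thus ?thesis using g by (simp add: m_assoc) (simp add: m_assoc[symmetric])
    qed
    thus ?thesis by (simp add: image_image)
  qed
  ultimately have "T = R" using g by simp
  thus False using T R by simp
qed

lemma redundant_if_not_unique:
  assumes "\<And>x. x \<in> p_elements G p \<Longrightarrow>
     \<exists>P\<in>Sylow_subgroups G p. \<exists>Q\<in>Sylow_subgroups G p. x \<in> P \<and> x \<in> Q \<and> P \<noteq> Q"
  shows "has_redundant_Sylow G p"
proof -
  obtain P where P: "P \<in> Sylow_subgroups G p" using Sylow_exists by blast
  have "p_elements G p \<subseteq> \<Union>(Sylow_subgroups G p - {P})"
  proof
    fix x assume "x \<in> p_elements G p"
    then obtain A B where "A \<in> Sylow_subgroups G p" "B \<in> Sylow_subgroups G p" "x \<in> A" "x \<in> B" "A \<noteq> B"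
      using assms by blast
    thus "x \<in> \<Union>(Sylow_subgroups G p - {P})" by (cases "A = P") auto
  qed
  moreover have "Sylow_subgroups G p - {P} \<subset> Sylow_subgroups G p" using P by blast
  ultimately show ?thesis unfolding has_redundant_Sylow_def by blast
qed

text \<open>By maximality each Sylow subgroup of \<open>A\<close> is \<open>P \<inter> A\<close> for
  a Sylow subgroup \<open>P\<close> of the whole group, so uniqueness of \<open>P\<close> forces
  uniqueness in \<open>A\<close>. This lets the result for symmetric groups serve alternating
  groups.\<close>

lemma subgroup_not_redundant_if_unique:
  assumes A: "subgroup A G" and xA: "x \<in> A" and x: "x [^] (p ^ k :: nat) = \<one>"
    and uniq: "\<And>P Q. P \<in> Sylow_subgroups G p \<Longrightarrow> Q \<in> Sylow_subgroups G p \<Longrightarrow> x \<in> P \<Longrightarrow> x \<in> Q \<Longrightarrow> P = Q"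
  shows "\<not> has_redundant_Sylow (G\<lparr>carrier := A\<rparr>) p"
proof -
  interpret A: group "G\<lparr>carrier := A\<rparr>" using A by (rule subgroup_imp_group)
  have AG: "A \<subseteq> carrier G" using A by (rule subgroup.subset)
  interpret A: finite_group_prime "G\<lparr>carrier := A\<rparr>" p
    by unfold_locales (use prime_p AG finite_carrier finite_subset in auto)
  have ext: "\<exists>P\<in>Sylow_subgroups G p. Q = P \<inter> A" if Q: "Q \<in> Sylow_subgroups (G\<lparr>carrier := A\<rparr>) p" for Q
  proof -
    have Qs: "subgroup Q (G\<lparr>carrier := A\<rparr>)" using Q unfolding Sylow_subgroups_def by blast
    hence QG: "subgroup Q G" using A incl_subgroup by blast
    have QA: "Q \<subseteq> A" using subgroup.subset[OF Qs] by simp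
    obtain P where P: "P \<in> Sylow_subgroups G p" "Q \<subseteq> P"
      using p_subgroup_in_Sylow[OF QG] Q unfolding Sylow_subgroups_def by blast
    have "subgroup (P \<inter> A) G" using P A subgroups_Inter_pair unfolding Sylow_subgroups_def by blast
    hence PA: "subgroup (P \<inter> A) (G\<lparr>carrier := A\<rparr>)"
      using A subgroup_incl by blast
    moreover obtain j where "card (P \<inter> A) = p ^ j"
      using card_p_subgroup[OF prime_p finite_carrier \<open>subgroup (P \<inter> A) G\<close>] Sylow_element_p_power[OF P(1)]
      by blast
    ultimately have "Q = P \<inter> A" using A.Sylow_maximal[OF Q PA] P QA by blast
    thus ?thesis using P by blast
  qed
  show ?thesis
  proof (rule A.not_redundant_if_unique)
    have "x [^]\<^bsub>G\<lparr>carrier := A\<rparr>\<^esub> (p ^ k :: nat) = \<one>" using x by (simp add: nat_pow_def)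
    thus "x \<in> p_elements (G\<lparr>carrier := A\<rparr>) p" using xA by (auto simp: A.mem_p_elements_iff)
  next
    fix P Q assume "P \<in> Sylow_subgroups (G\<lparr>carrier := A\<rparr>) p" "Q \<in> Sylow_subgroups (G\<lparr>carrier := A\<rparr>) p"
      "x \<in> P" "x \<in> Q"
    thus "P = Q" using ext uniq by (metis IntD1)
  qed
qed

end

section \<open>Cycles of a permutation\<close>

text \<open>Forward iterates reach the whole cycle, since a permutation of finite support has a
  positive power equal to \<open>id\<close>. Fixed points count as cycles of length 1.\<close>

definition cyc :: "('a \<Rightarrow> 'a) \<Rightarrow> 'a \<Rightarrow> 'a set" where
  "cyc x y = range (\<lambda>k. (x ^^ k) y)"

lemma self_in_cyc [simp]: "y \<in> cyc x y"
  unfolding cyc_def by (metis funpow_0 rangeI)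

lemma funpow_in_cyc [simp]: "(x ^^ k) y \<in> cyc x y"
  unfolding cyc_def by blast

lemma apply_in_cyc [simp]: "x y \<in> cyc x y"
  using funpow_in_cyc[of 1 x y] by simp

lemma funpow_fixed: "x y = y \<Longrightarrow> (x ^^ k) y = y"
  by (induction k) auto

lemma cyc_fixed: "x y = y \<Longrightarrow> cyc x y = {y}"
  unfolding cyc_def by (auto simp: funpow_fixed)

lemma cyc_eq:
  assumes "permutation x" "w \<in> cyc x y"
  shows "cyc x w = cyc x y"
proof
  obtain k where k: "w = (x ^^ k) y" using assms unfolding cyc_def by blast
  show "cyc x w \<subseteq> cyc x y" unfolding k cyc_def
    by (auto simp: funpow_add[unfolded comp_def fun_eq_iff, rule_format, symmetric])
  \<comment> \<open>Returning from \<open>w\<close> to \<open>y\<close> takes \<open>N - k\<close>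
    further steps, whence \<open>N > k\<close>.\<close>
  obtain N where N: "x ^^ N = id" "N > k" using permutation_is_nilpotent'[OF assms(1)] by metis
  have "y = (x ^^ (N - k)) w"
    unfolding k using N by (metis add.commute comp_apply diff_add_inverse funpow_add id_apply
        le_add_diff_inverse less_imp_le_nat)
  hence "(x ^^ j) y \<in> cyc x w" for j by (metis comp_apply funpow_add funpow_in_cyc)
  thus "cyc x y \<subseteq> cyc x w" unfolding cyc_def[of x y] by blast
qed

lemma cyc_eq_iff: "permutation x \<Longrightarrow> cyc x w = cyc x y \<longleftrightarrow> w \<in> cyc x y"
  using cyc_eq by (metis self_in_cyc)

lemma cyc_subset:
  assumes "x permutes S" "y \<in> S"
  shows "cyc x y \<subseteq> S"
  using assms permutes_funpow[OF assms(1)] unfolding cyc_def by (auto simp: permutes_in_image)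

lemma card_cyc:
  assumes "permutation x"
  shows "card (cyc x y) = least_power x y"
proof -
  have "cyc x y = set (support x y)" using support_set[OF assms] unfolding cyc_def by simp
  thus ?thesis using distinct_card[OF cycle_of_permutation[OF assms]] by simp
qed

lemma finite_cyc: "permutation x \<Longrightarrow> finite (cyc x y)"
  using support_set unfolding cyc_def by (metis List.finite_set)

lemma card_cyc_pos: "permutation x \<Longrightarrow> card (cyc x y) > 0"
  by (simp add: card_cyc least_power_of_permutation)

lemma funpow_eq_self_iff:
  assumes "permutation x"
  shows "(x ^^ k) y = y \<longleftrightarrow> card (cyc x y) dvd k"
  using least_power_dvd[OF assms] by (simp add: card_cyc[OF assms])

lemma card_cyc_eq_1_iff:
  assumes "permutation x"
  shows "card (cyc x y) = 1 \<longleftrightarrow> x y = y"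
  using funpow_eq_self_iff[OF assms, of 1 y] by auto

lemma card_cyc_prime_power:
  assumes "permutation x" "Factorial_Ring.prime p" "x ^^ (p ^ k) = id"
  shows "\<exists>j. card (cyc x y) = p ^ j"
proof -
  have "card (cyc x y) dvd p ^ k" using funpow_eq_self_iff[OF assms(1), of "p ^ k" y] assms(3) by simp
  thus ?thesis using assms(2) by (auto simp: divides_primepow_nat)
qed

lemma card_cyc_prime:
  assumes "permutation x" "Factorial_Ring.prime p" "x ^^ p = id" "x y \<noteq> y"
  shows "card (cyc x y) = p"
proof -
  have "card (cyc x y) dvd p" using funpow_eq_self_iff[OF assms(1), of p y] assms(3) by simp
  thus ?thesis using assms card_cyc_eq_1_iff[OF assms(1), of y] by (auto simp: prime_nat_iff)
qed

lemma moved_cyc: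
  assumes "permutation x" "w \<in> cyc x y" "x y \<noteq> y"
  shows "x w \<noteq> w"
  using assms card_cyc_eq_1_iff[OF assms(1)] cyc_eq[OF assms(1,2)] by metis

lemma funpow_commute:
  assumes "x \<circ> z = z \<circ> x"
  shows "(x ^^ k) ((z ^^ j) y) = (z ^^ j) ((x ^^ k) y)"
proof -
  have 1: "x ((z ^^ j) y) = (z ^^ j) (x y)" for j y
    by (induction j) (simp_all add: comp_eq_dest[OF assms])
  show ?thesis by (induction k) (simp_all add: 1)
qed

lemma funpow_commute1:
  assumes "x \<circ> z = z \<circ> x"
  shows "x ((z ^^ j) y) = (z ^^ j) (x y)"
  using funpow_commute[OF assms, of 1 j y] by simp

lemma funpow_comp_commute: "x \<circ> z = z \<circ> x \<Longrightarrow> (x ^^ k) \<circ> z = z \<circ> (x ^^ k)"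
  using funpow_commute[of x z k 1] by (auto simp: fun_eq_iff)

lemma comp_commute: "g \<circ> z = z \<circ> g \<Longrightarrow> h \<circ> z = z \<circ> h \<Longrightarrow> (g \<circ> h) \<circ> z = z \<circ> (g \<circ> h)"
  by (metis comp_assoc)

text \<open>This is why the centralizer of \<open>z\<close> acts on the set of cycles of
  \<open>z\<close>.\<close>

lemma image_cyc:
  assumes "g \<circ> z = z \<circ> g"
  shows "g ` cyc z y = cyc z (g y)"
  unfolding cyc_def using funpow_commute1[OF assms] by (auto simp: image_image)

lemma funpow_dvd_id:
  assumes "x ^^ m = id" "m dvd n"
  shows "x ^^ n = id"
  using assms by (auto simp: funpow_mult[symmetric] elim!: dvdE)

lemma permutes_permutation: "x permutes S \<Longrightarrow> finite S \<Longrightarrow> permutation x"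
  using permutation_permutes by blast

lemma cyclic_permutation_exists:
  assumes "finite C"
  shows "\<exists>c. c permutes C \<and> (\<forall>y\<in>C. cyc c y = C)"
proof -
  obtain cs where cs: "set cs = C" "distinct cs" using finite_distinct_list[OF assms] by blast
  let ?c = "cycle_of_list cs"
  have perm: "?c permutes C" using cycle_permutes[of cs] cs by simp
  have "cyc ?c y = C" if y: "y \<in> C" for y
  proof
    show "cyc ?c y \<subseteq> C" using cyc_subset[OF perm y] .
    obtain i where i: "i < length cs" "cs ! i = y" using y cs by (metis in_set_conv_nth)
    show "C \<subseteq> cyc ?c y"
    proof
      fix w assume "w \<in> C"
      then obtain j where j: "j < length cs" "cs ! j = w" using cs by (metis in_set_conv_nth)
      \<comment> \<open>A full turn is added so that going from position \<open>i\<close> to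
        position \<open>j\<close> works also for \<open>j < i\<close> in natural numbers.\<close>
      let ?k = "length cs - i + j"
      have "(?c ^^ ?k) (cs ! i) = rotate ?k cs ! i"
        using cyclic_rotation[OF cs(2), of ?k] i by (metis nth_map)
      also have "\<dots> = cs ! ((?k + i) mod length cs)" using i by (simp add: nth_rotate add.commute)
      also have "(?k + i) mod length cs = j" using i j by simp
      finally show "w \<in> cyc ?c y" using i j by (metis funpow_in_cyc)
    qed
  qed
  thus ?thesis using perm by blast
qed

section \<open>Permutation groups of prime power order\<close>

text \<open>Stated without an ambient group structure, so that one and the same set of permutations
  can be regarded as a subgroup of \<open>sym_on S\<close>, \<open>sym_group n\<close> or
  \<open>alt_group n\<close>.\<close>

definition p_perm_group :: "nat \<Rightarrow> 'a set \<Rightarrow> ('a \<Rightarrow> 'a) set \<Rightarrow> bool" where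
  "p_perm_group p S P \<longleftrightarrow> id \<in> P \<and> (\<forall>g\<in>P. \<forall>h\<in>P. g \<circ> h \<in> P) \<and>
     (\<forall>g\<in>P. g permutes S \<and> (\<exists>k. g ^^ (p ^ k) = id))"

lemma p_perm_group_permutes: "p_perm_group p S P \<Longrightarrow> g \<in> P \<Longrightarrow> g permutes S"
  and p_perm_group_funpow_id: "p_perm_group p S P \<Longrightarrow> g \<in> P \<Longrightarrow> \<exists>k. g ^^ (p ^ k) = id"
  and p_perm_group_id: "p_perm_group p S P \<Longrightarrow> id \<in> P"
  and p_perm_group_comp: "p_perm_group p S P \<Longrightarrow> g \<in> P \<Longrightarrow> h \<in> P \<Longrightarrow> g \<circ> h \<in> P"
  unfolding p_perm_group_def by blast+

lemma p_perm_group_funpow: "p_perm_group p S P \<Longrightarrow> g \<in> P \<Longrightarrow> g ^^ k \<in> P"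
  by (induction k) (auto simp: p_perm_group_id p_perm_group_comp)

text \<open>With \<open>a ^^ (p ^ k) = id\<close>, the inverse of \<open>a\<close> is a power of
  \<open>a\<close>, so closure under composition yields closure under inverses.\<close>

lemma p_perm_group_subgroup:
  assumes G: "group G" "monoid.mult G = (\<circ>)" "monoid.one G = id" and P: "p_perm_group p S P"
    and sub: "P \<subseteq> carrier G" and p: "p > 0"
  shows "subgroup P G"
proof -
  interpret group G by fact
  show ?thesis
  proof (rule subgroupI[OF sub])
    show "P \<noteq> {}" using p_perm_group_id[OF P] by blast
    fix a assume a: "a \<in> P"
    obtain k where k: "a ^^ (p ^ k) = id" using p_perm_group_funpow_id[OF P a] by blast
    define b where "b = a ^^ (p ^ k - 1)"
    have b: "b \<in> P" unfolding b_def using p_perm_group_funpow[OF P a] .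
    have "p ^ k = Suc (p ^ k - 1)" using p by simp
    hence "b \<circ> a = id" unfolding b_def using k by (metis funpow_Suc_right)
    hence "inv\<^bsub>G\<^esub> a = b" using inv_equality[of b a] a b sub G by auto
    thus "inv\<^bsub>G\<^esub> a \<in> P" using b by simp
  qed (use p_perm_group_comp[OF P] G in auto)
qed

lemma nat_pow_eq_funpow:
  assumes "monoid.mult G = (\<circ>)" "monoid.one G = id"
  shows "x [^]\<^bsub>G\<^esub> (k::nat) = x ^^ k"
  by (induction k) (simp_all add: assms nat_pow_def funpow_Suc_right del: funpow.simps)

text \<open>The descent through the levels of a tower meets arbitrary finite sets of points, whereas
  \<open>sym_group\<close> acts on \<open>{1..n}\<close> only.\<close>

definition sym_on :: "'a set \<Rightarrow> ('a \<Rightarrow> 'a) monoid" where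
  "sym_on S = \<lparr>carrier = {g. g permutes S}, monoid.mult = (\<circ>), monoid.one = id\<rparr>"

lemma sym_on_simps [simp]:
  "carrier (sym_on S) = {g. g permutes S}" "monoid.mult (sym_on S) = (\<circ>)" "monoid.one (sym_on S) = id"
  unfolding sym_on_def by simp_all

lemma group_sym_on: "group (sym_on S)"
proof (rule groupI)
  fix x assume "x \<in> carrier (sym_on S)"
  thus "\<exists>y\<in>carrier (sym_on S). y \<otimes>\<^bsub>sym_on S\<^esub> x = \<one>\<^bsub>sym_on S\<^esub>"
    using permutes_inv permutes_inv_o(2) by fastforce
qed (auto simp: permutes_compose comp_assoc)

lemma p_perm_group_central:
  assumes p: "Factorial_Ring.prime p" and fin: "finite S" and P: "p_perm_group p S P" and nt: "P \<noteq> {id}"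
  shows "\<exists>c\<in>P. c \<noteq> id \<and> c ^^ p = id \<and> (\<forall>g\<in>P. g \<circ> c = c \<circ> g)"
proof -
  interpret group "sym_on S" by (rule group_sym_on)
  have PS: "subgroup P (sym_on S)"
    using p_perm_group_subgroup[OF group_sym_on _ _ P] p_perm_group_permutes[OF P] p
    by (auto simp: prime_gt_0_nat)
  have pow: "x [^]\<^bsub>sym_on S\<^esub> (k::nat) = x ^^ k" for x k by (rule nat_pow_eq_funpow) auto
  obtain k where k: "card P = p ^ k"
    using card_p_subgroup[OF p _ PS] fin finite_permutations[OF fin] p_perm_group_funpow_id[OF P] by (auto simp: pow)
  interpret P: group "sym_on S\<lparr>carrier := P\<rparr>" using PS by (rule subgroup_imp_group)
  have "x [^]\<^bsub>sym_on S\<lparr>carrier := P\<rparr>\<^esub> (k::nat) = x ^^ k" for x k by (rule nat_pow_eq_funpow) auto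
  thus ?thesis using P.p_group_central_element[OF p, of k] k nt by simp
qed

section \<open>Towers\<close>

text \<open>Cycles are represented by their least elements, so that the type does not change when the passage to
  the induced action is iterated.\<close>

definition cyc_rep :: "(nat \<Rightarrow> nat) \<Rightarrow> nat \<Rightarrow> nat" where
  "cyc_rep z y = (LEAST w. w \<in> cyc z y)"

definition moved_reps :: "(nat \<Rightarrow> nat) \<Rightarrow> nat set" where
  "moved_reps z = {y. z y \<noteq> y \<and> cyc_rep z y = y}"

text \<open>For \<open>g\<close> commuting with \<open>z\<close> this is the action of
  \<open>g\<close> on the nontrivial cycles of \<open>z\<close>. It is the identity elsewhere, so
  that it permutes \<open>moved_reps z\<close>.\<close>

definition quo :: "(nat \<Rightarrow> nat) \<Rightarrow> (nat \<Rightarrow> nat) \<Rightarrow> nat \<Rightarrow> nat" where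
  "quo z g y = (if y \<in> moved_reps z then cyc_rep z (g y) else y)"

lemma cyc_rep_in_cyc: "cyc_rep z y \<in> cyc z y"
  unfolding cyc_rep_def by (rule LeastI[of _ y]) simp

lemma cyc_rep_eq_iff:
  assumes "permutation z"
  shows "cyc_rep z y = cyc_rep z w \<longleftrightarrow> w \<in> cyc z y"
proof
  assume "cyc_rep z y = cyc_rep z w"
  hence "cyc z y = cyc z w" using cyc_eq[OF assms cyc_rep_in_cyc] by metis
  thus "w \<in> cyc z y" by simp
next
  assume "w \<in> cyc z y"
  thus "cyc_rep z y = cyc_rep z w" unfolding cyc_rep_def using cyc_eq[OF assms] by metis
qed

lemma cyc_rep_idem: "permutation z \<Longrightarrow> cyc_rep z (cyc_rep z y) = cyc_rep z y"
  using cyc_rep_eq_iff cyc_rep_in_cyc by metis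

lemma cyc_rep_in_moved_reps: "permutation z \<Longrightarrow> z y \<noteq> y \<Longrightarrow> cyc_rep z y \<in> moved_reps z"
  unfolding moved_reps_def using moved_cyc[OF _ cyc_rep_in_cyc] cyc_rep_idem by blast

lemma moved_reps_subset: "z permutes S \<Longrightarrow> moved_reps z \<subseteq> S"
  unfolding moved_reps_def using permutes_not_in by fastforce

text \<open>A point and its image under \<open>z\<close> cannot both be the least element of a
  nontrivial cycle, so one of them is left out. This makes the passage to cycles terminate.\<close>

lemma moved_reps_psubset:
  assumes z: "z permutes S" "permutation z" and "S \<noteq> {}"
  shows "moved_reps z \<subset> S"
proof -
  obtain y where y: "y \<in> S" using assms by blast
  have "z y \<notin> moved_reps z" if "y \<in> moved_reps z"
    using that cyc_rep_eq_iff[OF z(2), of y "z y"] unfolding moved_reps_def by auto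
  moreover have "z y \<in> S" using y z by (simp add: permutes_in_image)
  ultimately show ?thesis using y moved_reps_subset[OF z(1)] by blast
qed

lemma commute_moved:
  assumes "permutation g" "g \<circ> z = z \<circ> g"
  shows "z (g y) \<noteq> g y \<longleftrightarrow> z y \<noteq> y"
  using comp_eq_dest[OF assms(2), of y] permutation_bijective[OF assms(1)]
  by (metis bij_def inj_eq)

lemma cyc_rep_commute:
  assumes "permutation z" "g \<circ> z = z \<circ> g"
  shows "cyc_rep z (g (cyc_rep z y)) = cyc_rep z (g y)"
proof -
  have "g (cyc_rep z y) \<in> cyc z (g y)" using image_cyc[OF assms(2), of y] cyc_rep_in_cyc by blast
  thus ?thesis using cyc_rep_eq_iff[OF assms(1)] by metis
qed

lemma quo_id: "quo z id = id"
  unfolding quo_def moved_reps_def by auto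

lemma quo_comp:
  assumes z: "permutation z" and g: "permutation g" "g \<circ> z = z \<circ> g"
    and h: "permutation h" "h \<circ> z = z \<circ> h"
  shows "quo z (g \<circ> h) = quo z g \<circ> quo z h"
proof
  fix y
  show "quo z (g \<circ> h) y = (quo z g \<circ> quo z h) y"
  proof (cases "y \<in> moved_reps z")
    case True
    hence "cyc_rep z (h y) \<in> moved_reps z"
      using commute_moved[OF h, of y] cyc_rep_in_moved_reps[OF z] unfolding moved_reps_def by blast
    thus ?thesis using True cyc_rep_commute[OF z g(2)] unfolding quo_def by simp
  qed (simp add: quo_def)
qed

lemma quo_funpow:
  assumes z: "permutation z" and g: "permutation g" "g \<circ> z = z \<circ> g"
  shows "quo z (g ^^ k) = quo z g ^^ k"
proof (induction k)
  case (Suc k)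
  have "quo z (g \<circ> g ^^ k) = quo z g \<circ> quo z (g ^^ k)"
    using g z by (intro quo_comp permutation_funpow funpow_comp_commute)
  thus ?case using Suc by (metis funpow.simps(2))
qed (metis funpow.simps(1) quo_id)

text \<open>By \<open>quo_funpow\<close> some positive power of \<open>quo z g\<close> is the
  identity, and this gives bijectivity.\<close>

lemma quo_permutes:
  assumes z: "permutation z" and g: "permutation g" "g \<circ> z = z \<circ> g"
  shows "quo z g permutes moved_reps z"
proof -
  obtain N where N: "g ^^ N = id" "N > 0" using permutation_is_nilpotent[OF g(1)] by metis
  hence pow: "quo z g ^^ N = id" using quo_funpow[OF assms, of N] quo_id by metis
  obtain M where "N = Suc M" using N by (cases N) auto
  hence "quo z g \<circ> (quo z g ^^ M) = id" "(quo z g ^^ M) \<circ> quo z g = id"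
    using pow funpow_Suc_right by (metis funpow.simps(2))+
  hence "bij (quo z g)" using o_bij by blast
  thus ?thesis unfolding permutes_def bij_iff by (auto simp: quo_def)
qed

text \<open>For prime \<open>p\<close> the new group is the wreath product of the cyclic group of
  order \<open>p\<close> with \<open>W\<close>, acting on the nontrivial cycles of \<open>z\<close>.
  Fewer than \<open>p\<close> fixed points means that \<open>z\<close> has as many cycles of length
  \<open>p\<close> as possible, which is what makes these iterated wreath products Sylow
  subgroups.\<close>

inductive tower :: "nat \<Rightarrow> nat set \<Rightarrow> (nat \<Rightarrow> nat) set \<Rightarrow> bool" for p where
  empty: "tower p {} {id}"
| step: "\<lbrakk>finite S; z permutes S; z ^^ p = id; card {y \<in> S. z y = y} < p; tower p (moved_reps z) W\<rbrakk>
    \<Longrightarrow> tower p S {g. g permutes S \<and> g \<circ> z = z \<circ> g \<and> (\<forall>y. z y = y \<longrightarrow> g y = y) \<and> quo z g \<in> W}"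

text \<open>If \<open>h = g ^^ (p ^ k)\<close> acts trivially on the cycles of \<open>z\<close>,
  then on each cycle it is a power of \<open>z\<close>, so \<open>h ^^ p = id\<close>. Thus each
  level costs one more factor \<open>p\<close> in the exponent.\<close>

lemma tower_p_perm_group: "tower p S W \<Longrightarrow> p_perm_group p S W"
proof (induction rule: tower.induct)
  case empty
  show ?case unfolding p_perm_group_def by (auto intro: exI[of _ 0])
next
  case (step S z W)
  have z: "permutation z" using step permutes_permutation by blast
  let ?W = "{g. g permutes S \<and> g \<circ> z = z \<circ> g \<and> (\<forall>y. z y = y \<longrightarrow> g y = y) \<and> quo z g \<in> W}"
  have "id \<in> ?W" using p_perm_group_id[OF step.IH] by (simp add: quo_id)
  moreover have "g \<circ> h \<in> ?W" if g: "g \<in> ?W" and h: "h \<in> ?W" for g h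
  proof -
    have "g \<circ> h \<circ> z = z \<circ> (g \<circ> h)" using g h by (intro comp_commute) auto
    moreover have "quo z (g \<circ> h) \<in> W"
      using g h quo_comp[OF z, of g h] permutes_permutation[OF _ step(1)] p_perm_group_comp[OF step.IH] by simp
    moreover have "g \<circ> h permutes S" using g h permutes_compose by blast
    ultimately show ?thesis using g h by simp
  qed
  moreover have "\<exists>k. g ^^ (p ^ k) = id" if g: "g \<in> ?W" for g
  proof -
    have gp: "permutation g" and gc: "g \<circ> z = z \<circ> g"
      using g permutes_permutation[OF _ step(1)] by auto
    obtain k where k: "quo z g ^^ (p ^ k) = id" using p_perm_group_funpow_id[OF step.IH] g by blast
    define h where "h = g ^^ (p ^ k)"
    have hc: "h \<circ> z = z \<circ> h" unfolding h_def using funpow_comp_commute[OF gc] .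
    have hp: "permutation h" unfolding h_def using permutation_funpow[OF gp] .
    have qh: "quo z h = id" unfolding h_def using k quo_funpow[OF z gp gc] by simp
    have fix_h: "h y = y" if "z y = y" for y
      using g that unfolding h_def by (intro funpow_fixed) auto
    have "(h ^^ p) y = y" for y
    proof (cases "z y = y")
      case True
      show ?thesis using fix_h[OF True] by (rule funpow_fixed)
    next
      case False
      let ?r = "cyc_rep z y"
      have r: "?r \<in> moved_reps z" using cyc_rep_in_moved_reps[OF z False] .
      have "cyc_rep z (h y) = cyc_rep z (h ?r)" using cyc_rep_commute[OF z hc] by simp
      also have "\<dots> = ?r" using fun_cong[OF qh, of ?r] r by (simp add: quo_def)
      finally have "h y \<in> cyc z y" using cyc_rep_eq_iff[OF z, of y "h y"] by simp
      then obtain a where a: "h y = (z ^^ a) y" unfolding cyc_def by blast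
      \<comment> \<open>The exponent \<open>a\<close> depends on the cycle of \<open>y\<close>, but
        along this cycle it is constant because \<open>h\<close> commutes with
        \<open>z\<close>.\<close>
      have "(h ^^ j) y = (z ^^ (a * j)) y" for j
      proof (induction j)
        case (Suc j)
        have "(h ^^ Suc j) y = h ((z ^^ (a * j)) y)" using Suc by simp
        also have "\<dots> = (z ^^ (a * j)) (h y)" using funpow_commute1[OF hc] .
        also have "\<dots> = (z ^^ (a * j + a)) y" unfolding a by (simp add: funpow_add)
        finally show ?case by (simp add: algebra_simps)
      qed simp
      moreover have "z ^^ (a * p) = id" using funpow_dvd_id[OF step(3)] by simp
      ultimately show ?thesis by simp
    qed
    hence "h ^^ p = id" by auto
    hence "g ^^ (p ^ Suc k) = id" unfolding h_def by (simp add: funpow_mult mult.commute)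
    thus ?thesis by blast
  qed
  ultimately show ?case unfolding p_perm_group_def by blast
qed

section \<open>Every p-group of permutations lies in a tower group\<close>

lemma p_perm_group_restrict:
  assumes P: "p_perm_group p S P" and fin: "finite F" and inv: "\<And>g. g \<in> P \<Longrightarrow> g ` F \<subseteq> F"
  shows "p_perm_group p F ((\<lambda>g. restrict_id g F) ` P)"
proof -
  have perm: "restrict_id g F permutes F" if "g \<in> P" for g
  proof (rule permutes_restrict_id)
    have "inj_on g F" using p_perm_group_permutes[OF P that] permutes_inj_on by blast
    thus "bij_betw g F F" using inv[OF that] fin by (simp add: bij_betw_def endo_inj_surj)
  qed
  have comp: "restrict_id g F \<circ> restrict_id h F = restrict_id (g \<circ> h) F" if "h \<in> P" for g h
    using inv[OF that] by (auto simp: restrict_id_def fun_eq_iff)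
  have pow: "restrict_id g F ^^ k = restrict_id (g ^^ k) F" if "g \<in> P" for g k
  proof (induction k)
    case (Suc k)
    thus ?case using comp[of "g ^^ k" g] p_perm_group_funpow[OF P that] by simp
  qed (auto simp: restrict_id_def)
  have rid: "restrict_id id F = id" by (auto simp: restrict_id_def)
  show ?thesis unfolding p_perm_group_def
  proof (intro conjI ballI)
    show "id \<in> (\<lambda>g. restrict_id g F) ` P" using p_perm_group_id[OF P] rid by (metis imageI)
    fix a assume "a \<in> (\<lambda>g. restrict_id g F) ` P"
    then obtain g where g: "g \<in> P" "a = restrict_id g F" by blast
    show "a permutes F" using g perm by simp
    obtain k where "g ^^ (p ^ k) = id" using p_perm_group_funpow_id[OF P g(1)] by blast
    thus "\<exists>k. a ^^ (p ^ k) = id" using g pow rid by metis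
    fix b assume "b \<in> (\<lambda>g. restrict_id g F) ` P"
    then obtain h where h: "h \<in> P" "b = restrict_id h F" by blast
    show "a \<circ> b \<in> (\<lambda>g. restrict_id g F) ` P"
      using g h comp p_perm_group_comp[OF P] by (metis imageI)
  qed
qed

text \<open>Take \<open>z\<close> with the maximal number of moved points: if it had too many fixed points, it could be
  multiplied by a central element of the restriction of \<open>P\<close> to them, or by a \<open>p\<close>-cycle on them.\<close>

lemma centralizing_permutation_exists:
  assumes p: "Factorial_Ring.prime p" and fin: "finite S" and P: "p_perm_group p S P"
  shows "\<exists>z. z permutes S \<and> z ^^ p = id \<and> card {y \<in> S. z y = y} < p \<and>
     (\<forall>g\<in>P. g \<circ> z = z \<circ> g \<and> (\<forall>y. z y = y \<longrightarrow> g y = y))"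
proof -
  let ?A = "\<lambda>z. z permutes S \<and> z ^^ p = id \<and> (\<forall>g\<in>P. g \<circ> z = z \<circ> g)"
  let ?m = "\<lambda>z. card {y \<in> S. z y \<noteq> y}"
  have "?A id" by simp
  moreover have "\<And>z. ?A z \<longrightarrow> ?m z < Suc (card S)" using fin by (auto intro!: card_mono simp: less_Suc_eq_le)
  ultimately obtain z where z: "?A z" "\<And>w. ?A w \<Longrightarrow> ?m w \<le> ?m z"
    using ex_has_greatest_nat[of ?A id ?m "Suc (card S)"] by blast
  have zp: "z permutes S" "permutation z" using z permutes_permutation[OF _ fin] by auto
  define F where "F = {y \<in> S. z y = y}"
  have finF: "finite F" and FS: "F \<subseteq> S" unfolding F_def using fin by auto
  have inv: "g y \<in> F" if "g \<in> P" "y \<in> F" for g y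
  proof -
    have "g permutes S" "g \<circ> z = z \<circ> g" using that p_perm_group_permutes[OF P] z by auto
    thus ?thesis using that comp_eq_dest[of g z z g y] unfolding F_def by (auto simp: permutes_in_image)
  qed
  have inv': "g y \<notin> F" if "g \<in> P" "y \<notin> F" for g y
  proof -
    have "g permutes S" "permutation g" "g \<circ> z = z \<circ> g"
      using that p_perm_group_permutes[OF P] z permutes_permutation[OF _ fin] by auto
    thus ?thesis using that commute_moved[of g z y] unfolding F_def by (auto simp: permutes_in_image)
  qed
  \<comment> \<open>Such a \<open>c\<close> contradicts the choice of \<open>z\<close>, because
    \<open>z \<circ> c\<close> moves strictly more points; both remaining claims reduce to
    this.\<close>
  have no: False if c: "c permutes F" "c \<noteq> id" "c ^^ p = id" "\<And>g. g \<in> P \<Longrightarrow> g \<circ> c = c \<circ> g" for c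
  proof -
    have cz: "c \<circ> z = z \<circ> c"
    proof
      fix y show "(c \<circ> z) y = (z \<circ> c) y"
      proof (cases "y \<in> F")
        case True
        hence "c y \<in> F" using c by (simp add: permutes_in_image)
        thus ?thesis using True unfolding F_def by simp
      next
        case False
        have "z y \<notin> F"
        proof
          assume "z y \<in> F"
          hence "z (z y) = z y" "z y \<in> S" unfolding F_def by auto
          hence "z y = y" "y \<in> S" using zp(1) by (metis permutes_inj injD, metis permutes_in_image)
          thus False using False unfolding F_def by simp
        qed
        thus ?thesis using False c(1) by (simp add: permutes_not_in)
      qed
    qed
    have "?A (z \<circ> c)"
    proof (intro conjI ballI)
      show "z \<circ> c permutes S" using c(1) FS zp(1) permutes_compose permutes_subset by blast
      have "(z \<circ> c) ^^ k = z ^^ k \<circ> c ^^ k" for k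
      proof (induction k)
        case (Suc k)
        have "(z \<circ> c) ^^ Suc k = z \<circ> (c \<circ> z ^^ k) \<circ> c ^^ k" by (metis Suc comp_assoc funpow.simps(2))
        also have "c \<circ> z ^^ k = z ^^ k \<circ> c" using funpow_comp_commute[of z c k] cz by simp
        finally show ?case by (metis comp_assoc funpow.simps(2))
      qed simp
      thus "(z \<circ> c) ^^ p = id" using z c by simp
      fix g assume "g \<in> P"
      thus "g \<circ> (z \<circ> c) = z \<circ> c \<circ> g" using z c(4) by (metis comp_assoc)
    qed
    hence "?m (z \<circ> c) \<le> ?m z" by (rule z(2))
    moreover have "{y \<in> S. z y \<noteq> y} \<subset> {y \<in> S. (z \<circ> c) y \<noteq> y}"
    proof -
      obtain y where y: "c y \<noteq> y" using c(2) by fastforce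
      have "y \<in> F" using y c(1) permutes_not_in by metis
      moreover have "c y \<in> F" using \<open>y \<in> F\<close> c(1) by (simp add: permutes_in_image)
      ultimately have "y \<in> {y \<in> S. (z \<circ> c) y \<noteq> y}" "y \<notin> {y \<in> S. z y \<noteq> y}"
        using y unfolding F_def by auto
      moreover have "w \<in> {y \<in> S. (z \<circ> c) y \<noteq> y}" if "w \<in> {y \<in> S. z y \<noteq> y}" for w
      proof -
        have "w \<notin> F" using that unfolding F_def by simp
        thus ?thesis using that c(1) by (simp add: permutes_not_in)
      qed
      ultimately show ?thesis by blast
    qed
    hence "?m z < ?m (z \<circ> c)" using fin by (intro psubset_card_mono) auto
    ultimately show False by simp
  qed
  have triv: "g y = y" if g: "g \<in> P" and y: "y \<in> F" for g y
  proof (rule ccontr)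
    assume ne: "g y \<noteq> y"
    let ?R = "(\<lambda>g. restrict_id g F) ` P"
    have R: "p_perm_group p F ?R" using p_perm_group_restrict[OF P finF] inv by blast
    have "restrict_id g F \<noteq> id" using ne y by (metis id_apply restrict_id_simps(1))
    hence "?R \<noteq> {id}" using g by blast
    then obtain c where c: "c \<in> ?R" "c \<noteq> id" "c ^^ p = id" "\<And>h. h \<in> ?R \<Longrightarrow> h \<circ> c = c \<circ> h"
      using p_perm_group_central[OF p finF R] by blast
    have cp: "c permutes F" using p_perm_group_permutes[OF R c(1)] .
    have "h \<circ> c = c \<circ> h" if h: "h \<in> P" for h
    proof
      fix w
      have *: "(restrict_id h F \<circ> c) w = (c \<circ> restrict_id h F) w" using c(4) h by simp
      show "(h \<circ> c) w = (c \<circ> h) w"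
      proof (cases "w \<in> F")
        case True
        hence "c w \<in> F" using cp by (simp add: permutes_in_image)
        thus ?thesis using * True by simp
      next
        case False
        thus ?thesis using inv'[OF h False] cp by (simp add: permutes_not_in)
      qed
    qed
    thus False using no[OF cp c(2,3)] by blast
  qed
  \<comment> \<open>\<open>P\<close> is now known to be trivial on \<open>F\<close>, so any
    \<open>p\<close>-cycle inside \<open>F\<close> commutes with \<open>P\<close>.\<close>
  have "card F < p"
  proof (rule ccontr)
    assume "\<not> card F < p"
    then obtain C where C: "C \<subseteq> F" "card C = p"
      using obtain_subset_with_card_n[of p F] by auto
    have finC: "finite C" using C finF finite_subset by blast
    obtain c where c: "c permutes C" "\<And>y. y \<in> C \<Longrightarrow> cyc c y = C"
      using cyclic_permutation_exists[OF finC] by blast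
    have cp: "permutation c" using c(1) finC permutes_permutation by blast
    have "(c ^^ p) y = y" for y
    proof (cases "y \<in> C")
      case True
      thus ?thesis using funpow_eq_self_iff[OF cp] c(2) C by simp
    next
      case False
      thus ?thesis using permutes_not_in[OF permutes_funpow[OF c(1)]] by blast
    qed
    hence "c ^^ p = id" by auto
    moreover have "c \<noteq> id"
    proof
      assume id: "c = id"
      obtain y where y: "y \<in> C" using C p by fastforce
      have "card (cyc c y) = 1" using card_cyc_eq_1_iff[OF cp] id by simp
      thus False using c(2)[OF y] C p by simp
    qed
    moreover have "g \<circ> c = c \<circ> g" if g: "g \<in> P" for g
    proof
      fix w show "(g \<circ> c) w = (c \<circ> g) w"
      proof (cases "w \<in> F")
        case True
        moreover have "c w \<in> F" using True C c(1) permutes_in_image permutes_not_in by (metis subsetD)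
        ultimately show ?thesis using triv[OF g] by simp
      next
        case False
        thus ?thesis using inv'[OF g False] c(1) C permutes_not_in by (metis comp_apply subsetD)
      qed
    qed
    ultimately show False using no[of c] permutes_subset[OF c(1) C(1)] by blast
  qed
  moreover have "g y = y" if "g \<in> P" "z y = y" for g y
  proof (cases "y \<in> S")
    case True thus ?thesis using triv that unfolding F_def by blast
  next
    case False thus ?thesis using p_perm_group_permutes[OF P that(1)] by (simp add: permutes_not_in)
  qed
  ultimately show ?thesis using z unfolding F_def by blast
qed

text \<open>Induction on the number of points: the image of \<open>P\<close> under
  \<open>quo z\<close> lives on fewer of them. For a Sylow subgroup of the symmetric group the
  inclusion will become an equality.\<close>

lemma p_perm_group_in_tower:
  assumes p: "Factorial_Ring.prime p" and "finite S" "p_perm_group p S P"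
  shows "\<exists>W. tower p S W \<and> P \<subseteq> W"
  using assms(2,3)
proof (induction "card S" arbitrary: S P rule: less_induct)
  case less
  show ?case
  proof (cases "S = {}")
    case True
    have "P \<subseteq> {id}" using p_perm_group_permutes[OF less.prems(2)] True by auto
    thus ?thesis using True tower.empty by blast
  next
    case False
    obtain z where z: "z permutes S" "z ^^ p = id" "card {y \<in> S. z y = y} < p"
      "\<And>g. g \<in> P \<Longrightarrow> g \<circ> z = z \<circ> g" "\<And>g y. g \<in> P \<Longrightarrow> z y = y \<Longrightarrow> g y = y"
      using centralizing_permutation_exists[OF p less.prems] by blast
    have zp: "permutation z" using z less.prems permutes_permutation by blast
    have gp: "permutation g" if "g \<in> P" for g
      using that p_perm_group_permutes[OF less.prems(2)] less.prems(1) permutes_permutation by blast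
    let ?P = "quo z ` P"
    have "p_perm_group p (moved_reps z) ?P" unfolding p_perm_group_def
    proof (intro conjI ballI)
      show "id \<in> ?P" using p_perm_group_id[OF less.prems(2)] quo_id by (metis imageI)
      fix a assume "a \<in> ?P"
      then obtain g where g: "g \<in> P" "a = quo z g" by blast
      show "a permutes moved_reps z" using g quo_permutes[OF zp gp z(4)] by simp
      obtain k where "g ^^ (p ^ k) = id" using p_perm_group_funpow_id[OF less.prems(2) g(1)] by blast
      thus "\<exists>k. a ^^ (p ^ k) = id" using g quo_funpow[OF zp gp z(4)] quo_id by metis
      fix b assume "b \<in> ?P"
      then obtain h where h: "h \<in> P" "b = quo z h" by blast
      have "a \<circ> b = quo z (g \<circ> h)" using g h quo_comp[OF zp gp z(4) gp z(4)] by simp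
      thus "a \<circ> b \<in> ?P" using g h p_perm_group_comp[OF less.prems(2)] by blast
    qed
    moreover have sub: "moved_reps z \<subset> S" using moved_reps_psubset[OF z(1) zp False] .
    hence "card (moved_reps z) < card S" using less.prems(1) psubset_card_mono by blast
    moreover have "finite (moved_reps z)" using sub less.prems(1) finite_subset by blast
    ultimately obtain W where W: "tower p (moved_reps z) W" "?P \<subseteq> W" using less.hyps by blast
    have "P \<subseteq> {g. g permutes S \<and> g \<circ> z = z \<circ> g \<and> (\<forall>y. z y = y \<longrightarrow> g y = y) \<and> quo z g \<in> W}"
      using z W p_perm_group_permutes[OF less.prems(2)] by blast
    thus ?thesis using tower.step[OF less.prems(1) z(1-3) W(1)] by blast
  qed
qed

section \<open>Elements in a unique tower group\<close>

definition ncyc :: "('a \<Rightarrow> 'a) \<Rightarrow> 'a set \<Rightarrow> nat \<Rightarrow> nat" where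
  "ncyc x S m = card {A \<in> cyc x ` S. card A = m}"

definition good_type :: "nat \<Rightarrow> ('a \<Rightarrow> 'a) \<Rightarrow> 'a set \<Rightarrow> bool" where
  "good_type p x S \<longleftrightarrow> (\<forall>m. ncyc x S m < p \<or> (p = 2 \<and> m = 1 \<and> ncyc x S m = 2))"

section \<open>A permutation x of good type and a commuting z\<close>

locale commuting_pair =
  fixes p :: nat and S :: "nat set" and x z :: "nat \<Rightarrow> nat" and k :: nat
  assumes p: "Factorial_Ring.prime p" and fin: "finite S"
    and x: "x permutes S" "x ^^ (p ^ k) = id"
    and z: "z permutes S" "z ^^ p = id" "card {y \<in> S. z y = y} < p"
    and comm: "x \<circ> z = z \<circ> x"
    and good: "good_type p x S"
begin

lemma xp: "permutation x" and zp: "permutation z"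
  using x z fin permutes_permutation by auto

lemma finite_ncyc: "finite {A \<in> cyc x ` S. card A = m}"
  using fin by simp

text \<open>Fails only at an exceptional pair of fixed points for \<open>p = 2\<close>.\<close>

definition "regular y \<longleftrightarrow> ncyc x S (card (cyc x y)) < p"

text \<open>\<open>z\<close> permutes the fewer than \<open>p\<close> cycles of \<open>x\<close> of
  a given length in orbits of length 1 or \<open>p\<close>, hence fixes each of them. The proof
  finds by pigeonhole some \<open>z ^^ d\<close> with \<open>0 < d < p\<close> that preserves the
  cycle, and recovers \<open>z\<close> as a power of it.\<close>

lemma cyc_preserved:
  assumes y: "y \<in> S" and reg: "regular y"
  shows "z y \<in> cyc x y"
proof -
  let ?A = "cyc x y"
  have img: "(z ^^ i) ` ?A = cyc x ((z ^^ i) y)" for i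
    using image_cyc[OF funpow_comp_commute[OF comm[symmetric]]] by metis
  have injz: "inj (z ^^ i)" for i
    using permutes_inj[OF permutes_funpow[OF z(1)]] .
  have "\<not> inj_on (\<lambda>i. cyc x ((z ^^ i) y)) {..<p}"
  proof
    assume inj: "inj_on (\<lambda>i. cyc x ((z ^^ i) y)) {..<p}"
    have "(\<lambda>i. cyc x ((z ^^ i) y)) ` {..<p} \<subseteq> {A \<in> cyc x ` S. card A = card ?A}"
    proof (rule image_subsetI)
      fix i
      have "(z ^^ i) y \<in> S" using y permutes_funpow[OF z(1)] by (simp add: permutes_in_image)
      moreover have "card (cyc x ((z ^^ i) y)) = card ?A"
        using card_image[OF inj_on_subset[OF injz subset_UNIV], of i ?A] img[of i] by simp
      ultimately show "cyc x ((z ^^ i) y) \<in> {A \<in> cyc x ` S. card A = card ?A}" by blast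
    qed
    hence "card ((\<lambda>i. cyc x ((z ^^ i) y)) ` {..<p}) \<le> ncyc x S (card ?A)"
      unfolding ncyc_def using finite_ncyc card_mono by blast
    thus False using card_image[OF inj] reg unfolding regular_def by simp
  qed
  then obtain i j where ij: "i < p" "j < p" "i \<noteq> j" "cyc x ((z ^^ i) y) = cyc x ((z ^^ j) y)"
    unfolding inj_on_def by blast
  have "\<exists>d. 0 < d \<and> d < p \<and> (z ^^ d) ` ?A = ?A"
  proof -
    have *: "(z ^^ (j - i)) ` ?A = ?A" if "i < j" "cyc x ((z ^^ i) y) = cyc x ((z ^^ j) y)" for i j
    proof -
      have "(z ^^ i) ` ((z ^^ (j - i)) ` ?A) = (z ^^ i \<circ> z ^^ (j - i)) ` ?A" by (simp add: image_comp)
      also have "z ^^ i \<circ> z ^^ (j - i) = z ^^ j" using that(1) by (metis funpow_add le_add_diff_inverse less_imp_le_nat)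
      also have "(z ^^ j) ` ?A = (z ^^ i) ` ?A" using that img by simp
      finally show ?thesis using injz inj_image_eq_iff by metis
    qed
    show ?thesis
    proof (cases "i < j")
      case True thus ?thesis using *[of i j] ij by (intro exI[of _ "j - i"]) auto
    next
      case False thus ?thesis using *[of j i] ij by (intro exI[of _ "i - j"]) auto
    qed
  qed
  then obtain d where d: "0 < d" "d < p" "(z ^^ d) ` ?A = ?A" by blast
  have "gcd d p = 1"
    using d p prime_imp_coprime[of p d] by (metis coprime_iff_gcd_eq_1 gcd.commute nat_dvd_not_less)
  then obtain e b where e: "d * e = p * b + 1" using bezout_nat[of d p] d by auto
  have "((z ^^ d) ^^ n) ` ?A = ?A" for n
  proof (induction n)
    case (Suc n)
    have "((z ^^ d) ^^ Suc n) ` ?A = (z ^^ d) ` (((z ^^ d) ^^ n) ` ?A)" by (metis funpow.simps(2) image_comp)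
    thus ?case using Suc d(3) by simp
  qed simp
  hence "(z ^^ (d * e)) ` ?A = ?A" by (simp add: funpow_mult)
  moreover have "z ^^ (d * e) = z"
  proof -
    have "z ^^ (d * e) = z ^^ 1 \<circ> z ^^ (p * b)" using e by (metis add.commute funpow_add)
    also have "z ^^ (p * b) = id" using funpow_dvd_id[OF z(2)] by simp
    finally show ?thesis by simp
  qed
  ultimately have "z ` ?A = ?A" by metis
  thus ?thesis using imageI[OF self_in_cyc[of y x], of z] by simp
qed

lemma cyc_z_subset:
  assumes y: "y \<in> S" and reg: "regular y"
  shows "cyc z y \<subseteq> cyc x y"
proof -
  have "(z ^^ i) y \<in> cyc x y" for i
  proof (induction i)
    case (Suc i)
    let ?w = "(z ^^ i) y"
    have eq: "cyc x ?w = cyc x y" using cyc_eq[OF xp Suc] .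
    hence "regular ?w" using reg unfolding regular_def by simp
    moreover have "?w \<in> S" using y permutes_funpow[OF z(1)] by (simp add: permutes_in_image)
    ultimately show ?case using cyc_preserved[of ?w] eq by simp
  qed simp
  thus ?thesis unfolding cyc_def[of z] by blast
qed

text \<open>If \<open>z\<close> fixes \<open>y\<close>, it fixes the whole cycle of \<open>x\<close>
  through \<open>y\<close>; this has fewer than \<open>p\<close> points and a power of
  \<open>p\<close> as its length, so it is a single point. Conversely, \<open>cyc_preserved\<close>
  applies to a cycle of length 1.\<close>

lemma fixed_iff:
  assumes y: "y \<in> S" and reg: "regular y"
  shows "z y = y \<longleftrightarrow> x y = y"
proof
  assume "x y = y"
  thus "z y = y" using cyc_preserved[OF assms] cyc_fixed[of x y] by simp
next
  assume zy: "z y = y"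
  have "z w = w" if w: "w \<in> cyc x y" for w
  proof -
    obtain i where "w = (x ^^ i) y" using w unfolding cyc_def by blast
    thus ?thesis using zy funpow_commute1[OF comm[symmetric], of i y] by simp
  qed
  hence "cyc x y \<subseteq> {y \<in> S. z y = y}" using cyc_subset[OF x(1) y] by blast
  hence "card (cyc x y) \<le> card {y \<in> S. z y = y}" using fin by (intro card_mono) auto
  hence "card (cyc x y) < p" using z(3) by simp
  moreover obtain j where "card (cyc x y) = p ^ j" using card_cyc_prime_power[OF xp p x(2)] by blast
  ultimately have "card (cyc x y) = 1"
    using prime_gt_0_nat[OF p] by (cases j) auto
  thus "x y = y" using card_cyc_eq_1_iff[OF xp] by simp
qed

text \<open>The two fixed points of \<open>x\<close> form a set invariant under \<open>z\<close>,
  and for \<open>p = 2\<close> at most one point is fixed by \<open>z\<close>, so they are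
  swapped.\<close>

lemma irregular:
  assumes y: "y \<in> S" and irr: "\<not> regular y"
  shows "p = 2" "x y = y" "z y \<noteq> y" "{w \<in> S. x w = w} = {y, z y}"
proof -
  have 1: "p = 2" "card (cyc x y) = 1" "ncyc x S 1 = 2"
    using good irr unfolding good_type_def regular_def by auto
  show "p = 2" by fact
  show xy: "x y = y" using 1 card_cyc_eq_1_iff[OF xp] by simp
  let ?F = "{w \<in> S. x w = w}"
  have "{A \<in> cyc x ` S. card A = 1} = (\<lambda>w. {w}) ` ?F"
    using card_cyc_eq_1_iff[OF xp] cyc_fixed[of x] by (auto simp: image_iff)
  hence cF: "card ?F = 2" using 1(3) unfolding ncyc_def by (simp add: card_image)
  have zF: "z w \<in> ?F" if "w \<in> ?F" for w
    using that comp_eq_dest[OF comm, of w] z(1) by (auto simp: permutes_in_image)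
  have yF: "y \<in> ?F" using y xy by simp
  show "z y \<noteq> y"
  proof
    assume zy: "z y = y"
    have "card (?F - {y}) = 1" using cF yF fin by simp
    then obtain w where "?F - {y} = {w}" by (rule card_1_singletonE)
    hence w: "w \<in> ?F" "w \<noteq> y" "?F = {y, w}" using yF by blast+
    have "z w \<noteq> y" using zy w permutes_inj[OF z(1)] by (metis injD)
    hence "z w = w" using zF[OF w(1)] w(3) by blast
    hence "{y, w} \<subseteq> {y \<in> S. z y = y}" using zy w y by auto
    hence "card {y, w} \<le> card {y \<in> S. z y = y}" using fin by (intro card_mono) auto
    thus False using w z(3) 1(1) by auto
  qed
  hence "card {y, z y} = 2" by auto
  thus "?F = {y, z y}" using card_seteq[of ?F "{y, z y}"] cF zF[OF yF] yF fin by auto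
qed

text \<open>On a cycle of length \<open>p * q\<close> the permutation \<open>z\<close> agrees with
  some \<open>x ^^ a\<close>, and \<open>z ^^ p = id\<close> forces \<open>q\<close> to divide
  \<open>a\<close>. So \<open>z\<close> has the same cycle there as \<open>x ^^ q\<close>, which no
  longer depends on \<open>z\<close>.\<close>

lemma cyc_z_regular:
  assumes y: "y \<in> S" and reg: "regular y" and mv: "x y \<noteq> y"
  shows "cyc z y = cyc (x ^^ (card (cyc x y) div p)) y"
proof -
  define q where "q = card (cyc x y) div p"
  obtain j where j: "card (cyc x y) = p ^ j" using card_cyc_prime_power[OF xp p x(2)] by blast
  have "j \<noteq> 0" using j mv card_cyc_eq_1_iff[OF xp] by (metis power_0)
  hence L: "card (cyc x y) = p * q" unfolding q_def j using p by (cases j) auto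
  obtain a where a: "z y = (x ^^ a) y" using cyc_preserved[OF y reg] unfolding cyc_def by blast
  have za: "(z ^^ i) y = (x ^^ (a * i)) y" for i
  proof (induction i)
    case (Suc i)
    have "(z ^^ Suc i) y = z ((x ^^ (a * i)) y)" using Suc by simp
    also have "\<dots> = (x ^^ (a * i)) (z y)" using funpow_commute1[OF comm[symmetric]] .
    also have "\<dots> = (x ^^ (a * i + a)) y" unfolding a by (simp add: funpow_add)
    finally show ?case by (simp add: algebra_simps)
  qed simp
  have "(x ^^ (a * p)) y = y" using za[of p] z(2) by simp
  hence "p * q dvd a * p" using funpow_eq_self_iff[OF xp] L by simp
  hence "q dvd a" using p by (simp add: mult.commute[of a])
  then obtain b where b: "a = q * b" by blast
  have "(z ^^ i) y \<in> cyc (x ^^ q) y" for i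
  proof -
    have "(z ^^ i) y = ((x ^^ q) ^^ (b * i)) y" using za[of i] b by (simp add: funpow_mult mult.assoc)
    thus ?thesis by simp
  qed
  hence sub: "cyc z y \<subseteq> cyc (x ^^ q) y" unfolding cyc_def[of z] by blast
  have xq: "permutation (x ^^ q)" using permutation_funpow[OF xp] .
  have "((x ^^ q) ^^ p) y = y" using funpow_eq_self_iff[OF xp, of "q * p" y] L by (simp add: funpow_mult mult.commute)
  hence "card (cyc (x ^^ q) y) \<le> p"
    using funpow_eq_self_iff[OF xq] p by (metis dvd_imp_le prime_gt_0_nat)
  moreover have "card (cyc z y) = p"
    using card_cyc_prime[OF zp p z(2)] fixed_iff[OF y reg] mv by simp
  ultimately show ?thesis
    using sub card_seteq[OF finite_cyc[OF xq] sub] unfolding q_def by simp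
qed

lemma moved_reps_in: "b \<in> moved_reps z \<Longrightarrow> b \<in> S"
  using moved_reps_subset[OF z(1)] by blast

lemma cyc_quo:
  assumes b: "b \<in> moved_reps z"
  shows "cyc (quo z x) b = cyc_rep z ` cyc x b"
proof -
  have "(quo z x ^^ i) b = cyc_rep z ((x ^^ i) b)" for i
  proof -
    have "(quo z x ^^ i) b = quo z (x ^^ i) b" using quo_funpow[OF zp xp comm] by simp
    thus ?thesis using b by (simp add: quo_def)
  qed
  thus ?thesis unfolding cyc_def by (auto simp: image_image)
qed

text \<open>Every fibre of \<open>cyc_rep z\<close> on this cycle of \<open>x\<close> is a
  nontrivial cycle of \<open>z\<close> and has \<open>p\<close> elements.\<close>

lemma card_cyc_quo:
  assumes b: "b \<in> moved_reps z" and reg: "regular b"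
  shows "card (cyc x b) = p * card (cyc (quo z x) b)"
proof -
  have bS: "b \<in> S" using moved_reps_in[OF b] .
  have zb: "z b \<noteq> b" using b unfolding moved_reps_def by simp
  have fib: "card {w \<in> cyc x b. cyc_rep z w = c} = p" if c: "c \<in> cyc_rep z ` cyc x b" for c
  proof -
    obtain w where w: "w \<in> cyc x b" "c = cyc_rep z w" using c by blast
    have wS: "w \<in> S" using w cyc_subset[OF x(1) bS] by blast
    have eq: "cyc x w = cyc x b" using cyc_eq[OF xp w(1)] .
    have wr: "regular w" using reg eq unfolding regular_def by simp
    have "{v \<in> cyc x b. cyc_rep z v = c} = cyc z w"
      using w(2) cyc_rep_eq_iff[OF zp, of w] cyc_z_subset[OF wS wr] eq by (auto simp: eq_commute[of "cyc_rep z _" "cyc_rep z w"])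
    moreover have "x b \<noteq> b" using zb fixed_iff[OF bS reg] by simp
    hence "x w \<noteq> w" using moved_cyc[OF xp w(1)] by simp
    hence "z w \<noteq> w" using fixed_iff[OF wS wr] by simp
    ultimately show ?thesis using card_cyc_prime[OF zp p z(2)] by simp
  qed
  have "card (cyc x b) = (\<Sum>c\<in>cyc_rep z ` cyc x b. card {w \<in> cyc x b. cyc_rep z w = c})"
    using sum.image_gen[OF finite_cyc[OF xp, of b], of "\<lambda>_. 1::nat" "cyc_rep z"] by simp
  also have "\<dots> = p * card (cyc_rep z ` cyc x b)" using fib by simp
  finally show ?thesis using cyc_quo[OF b] by simp
qed

text \<open>Mapping a cycle of \<open>x\<close> of length \<open>p * m\<close> to its set of
  representatives reaches all cycles counted on the left; only one through an irregular point could
  escape.\<close>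

lemma ncyc_quo:
  assumes "\<And>b. b \<in> moved_reps z \<Longrightarrow> card (cyc (quo z x) b) = m \<Longrightarrow> regular b"
  shows "ncyc (quo z x) (moved_reps z) m \<le> ncyc x S (p * m)"
proof -
  have "{A \<in> cyc (quo z x) ` moved_reps z. card A = m}
      \<subseteq> (\<lambda>A. cyc_rep z ` A) ` {A \<in> cyc x ` S. card A = p * m}"
  proof clarify
    fix b assume b: "b \<in> moved_reps z" and m: "m = card (cyc (quo z x) b)"
    have "regular b" using assms b m by blast
    hence "cyc x b \<in> {A \<in> cyc x ` S. card A = p * m}"
      using card_cyc_quo[OF b] m moved_reps_in[OF b] by simp
    thus "cyc (quo z x) b \<in> (\<lambda>A. cyc_rep z ` A) ` {A \<in> cyc x ` S. card A = p * card (cyc (quo z x) b)}"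
      unfolding m by (rule image_eqI[where f = "(`) (cyc_rep z)", OF cyc_quo[OF b]])
  qed
  thus ?thesis unfolding ncyc_def by (rule surj_card_le[OF finite_ncyc])
qed

text \<open>For \<open>p = 2\<close> the swapped pair becomes one fixed point of
  \<open>quo z x\<close>, and besides it there is at most one more, coming from a cycle of length 2.
  So two fixed points may arise again but no more, and the exception in \<open>good_type\<close> is
  inherited.\<close>

lemma good_type_quo: "good_type p (quo z x) (moved_reps z)"
  unfolding good_type_def
proof
  fix m
  let ?N = "ncyc (quo z x) (moved_reps z) m"
  \<comment> \<open>A multiple of \<open>p\<close> is never 1, so the exceptional clause does not
    concern \<open>x\<close> at length \<open>p * m\<close>.\<close>
  have lt: "ncyc x S (p * m) < p"
  proof -
    have "p * m \<noteq> 1" using p by auto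
    thus ?thesis using good unfolding good_type_def by blast
  qed
  show "?N < p \<or> (p = 2 \<and> m = 1 \<and> ?N = 2)"
  proof (cases "\<forall>b\<in>moved_reps z. card (cyc (quo z x) b) = m \<longrightarrow> regular b")
    case True
    thus ?thesis using ncyc_quo[of m] lt by simp
  next
    case False
    then obtain b where b: "b \<in> moved_reps z" "card (cyc (quo z x) b) = m" "\<not> regular b" by blast
    note irr = irregular[OF moved_reps_in[OF b(1)] b(3)]
    have m1: "m = 1" using b(2) cyc_quo[OF b(1)] cyc_fixed[of x b] irr(2) by simp
    have "{A \<in> cyc (quo z x) ` moved_reps z. card A = m}
      \<subseteq> insert {b} ((\<lambda>A. cyc_rep z ` A) ` {A \<in> cyc x ` S. card A = p * m})"
    proof clarify
      fix c assume c: "c \<in> moved_reps z" and m: "m = card (cyc (quo z x) c)"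
        and no: "cyc (quo z x) c \<notin> (\<lambda>A. cyc_rep z ` A) ` {A \<in> cyc x ` S. card A = p * card (cyc (quo z x) c)}"
      have "\<not> regular c"
      proof
        assume "regular c"
        hence "cyc x c \<in> {A \<in> cyc x ` S. card A = p * card (cyc (quo z x) c)}"
          using card_cyc_quo[OF c] moved_reps_in[OF c] by simp
        thus False using no image_eqI[where f = "(`) (cyc_rep z)", OF cyc_quo[OF c]] by blast
      qed
      hence "x c = c" using irregular(2)[OF moved_reps_in[OF c]] by simp
      \<comment> \<open>Both points of the exceptional pair lie in one cycle of \<open>z\<close> and
        share its representative, so \<open>b\<close> is the only irregular one.\<close>
      hence "c \<in> {b, z b}" using irr(4) moved_reps_in[OF c] by blast
      hence "cyc_rep z b = cyc_rep z c" using cyc_rep_eq_iff[OF zp] by auto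
      hence "c = b" using b(1) c unfolding moved_reps_def by simp
      moreover have "card (cyc (quo z x) c) = 1" using m m1 by simp
      then obtain a where "cyc (quo z x) c = {a}" by (rule card_1_singletonE)
      ultimately show "cyc (quo z x) c = {b}" using self_in_cyc[of c "quo z x"] by (metis singletonD)
    qed
    hence "?N \<le> card (insert {b} ((\<lambda>A. cyc_rep z ` A) ` {A \<in> cyc x ` S. card A = p * m}))"
      unfolding ncyc_def using fin by (intro card_mono) auto
    also have "\<dots> \<le> Suc (card ((\<lambda>A. cyc_rep z ` A) ` {A \<in> cyc x ` S. card A = p * m}))"
      by (rule card_insert_le_m1) auto
    also have "\<dots> \<le> Suc (ncyc x S (p * m))"
      unfolding ncyc_def using card_image_le[OF finite_ncyc] by simp
    finally show ?thesis using lt irr(1) m1 by linarith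
  qed
qed

lemma ncyc_quo_less:
  assumes "\<And>m. ncyc x S m < p"
  shows "ncyc (quo z x) (moved_reps z) m < p"
proof -
  have "ncyc (quo z x) (moved_reps z) m \<le> ncyc x S (p * m)"
  proof (rule ncyc_quo)
    fix b show "regular b" unfolding regular_def by (rule assms)
  qed
  thus ?thesis using assms[of "p * m"] by simp
qed

end

text \<open>On regular points moved by \<open>x\<close> both cycles are those of the same power of
  \<open>x\<close>; on the exceptional pair both permutations are the swap.\<close>

lemma commuting_pair_cyc_eq:
  assumes "commuting_pair p S x z1 k" "commuting_pair p S x z2 k"
  shows "cyc z1 y = cyc z2 y"
proof -
  interpret a: commuting_pair p S x z1 k by fact
  interpret b: commuting_pair p S x z2 k by fact
  have reg_eq: "a.regular w \<longleftrightarrow> b.regular w" for w unfolding a.regular_def b.regular_def by simp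
  show ?thesis
  proof (cases "y \<in> S")
    case False
    thus ?thesis using a.z(1) b.z(1) by (simp add: cyc_fixed permutes_not_in)
  next
    case yS: True
    show ?thesis
    proof (cases "a.regular y")
      case True
      hence bT: "b.regular y" using reg_eq by simp
      show ?thesis
      proof (cases "x y = y")
        case True
        thus ?thesis using a.fixed_iff[OF yS \<open>a.regular y\<close>] b.fixed_iff[OF yS bT] by (simp add: cyc_fixed)
      next
        case False
        thus ?thesis using a.cyc_z_regular[OF yS True] b.cyc_z_regular[OF yS bT] by simp
      qed
    next
      case False
      hence bF: "\<not> b.regular y" using reg_eq by simp
      note ia = a.irregular[OF yS False] and ib = b.irregular[OF yS bF]
      have "cyc z1 y = {y, z1 y}"
        using card_seteq[OF finite_cyc[OF a.zp], of "{y, z1 y}" y] ia(1,3) card_cyc_prime[OF a.zp a.p a.z(2) ia(3)] by auto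
      moreover have "cyc z2 y = {y, z2 y}"
        using card_seteq[OF finite_cyc[OF b.zp], of "{y, z2 y}" y] ib(1,3) card_cyc_prime[OF b.zp b.p b.z(2) ib(3)] by auto
      ultimately show ?thesis using ia(4) ib(4) by simp
    qed
  qed
qed

text \<open>For odd \<open>p\<close>, \<open>z1\<close> and \<open>z2\<close> may differ by an exponent depending on the cycle of \<open>x\<close>, which is harmless
  for a \<open>g\<close> preserving these cycles.\<close>

lemma commuting_pair_commute:
  assumes "commuting_pair p S x z1 k" "commuting_pair p S x z2 k"
    and g: "g \<circ> z1 = z1 \<circ> g" and orb: "p \<noteq> 2 \<Longrightarrow> (\<And>y. g y \<in> cyc x y)"
  shows "g \<circ> z2 = z2 \<circ> g"
proof -
  interpret a: commuting_pair p S x z1 k by fact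
  interpret b: commuting_pair p S x z2 k by fact
  have eq: "cyc z1 y = cyc z2 y" for y using commuting_pair_cyc_eq[OF assms(1,2)] .
  show ?thesis
  proof (cases "p = 2")
    case True
    \<comment> \<open>A cycle of length at most 2 determines the permutation on it.\<close>
    have "z1 y = z2 y" for y
    proof (cases "z1 y = y")
      case True
      hence "cyc z2 y = {y}" using eq[of y] cyc_fixed[of z1 y] by simp
      thus ?thesis using True apply_in_cyc[of z2 y] by simp
    next
      case False
      have "card (cyc z1 y) = 2" using card_cyc_prime[OF a.zp a.p a.z(2) False] \<open>p = 2\<close> by simp
      moreover have "z2 y \<noteq> y" using False eq[of y] cyc_fixed[of z2 y] apply_in_cyc[of z1 y] by auto
      moreover have "{y, z1 y, z2 y} \<subseteq> cyc z1 y" using eq[of y] by auto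
      moreover have "finite (cyc z1 y)" using finite_cyc[OF a.zp] .
      ultimately have "card {y, z1 y, z2 y} \<le> 2" by (metis card_mono)
      thus ?thesis using False \<open>z2 y \<noteq> y\<close> by (auto simp: card_insert_if split: if_splits)
    qed
    hence "z1 = z2" by (rule ext)
    thus ?thesis using g by simp
  next
    case False
    show ?thesis
    proof
      fix y
      obtain e where e: "z2 y = (z1 ^^ e) y" using apply_in_cyc[of z2 y] eq[of y] unfolding cyc_def by blast
      obtain i where i: "g y = (x ^^ i) y" using orb[OF False, of y] unfolding cyc_def by blast
      have "g (z2 y) = (z1 ^^ e) (g y)" unfolding e using funpow_commute1[OF g] .
      also have "\<dots> = (x ^^ i) (z2 y)" unfolding i e using funpow_commute[OF a.comm] by simp
      also have "\<dots> = z2 (g y)" unfolding i using funpow_commute1[OF b.comm[symmetric]] by simp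
      finally show "(g \<circ> z2) y = (z2 \<circ> g) y" by simp
    qed
  qed
qed

text \<open>Supplies the last hypothesis of \<open>commuting_pair_commute\<close> for odd
  \<open>p\<close>. By induction \<open>quo z g\<close> preserves the cycles of
  \<open>quo z x\<close>; since the cycles of \<open>z\<close> lie inside those of \<open>x\<close>,
  this lifts to \<open>g\<close>.\<close>

lemma tower_orbits:
  assumes p: "Factorial_Ring.prime p"
  shows "tower p S W \<Longrightarrow> x \<in> W \<Longrightarrow> g \<in> W \<Longrightarrow> (\<And>m. ncyc x S m < p) \<Longrightarrow> g y \<in> cyc x y"
proof (induction arbitrary: x g y rule: tower.induct)
  case empty
  have "g = id" using empty(2) by blast
  thus ?case by simp
next
  case (step S z W)
  let ?W = "{g. g permutes S \<and> g \<circ> z = z \<circ> g \<and> (\<forall>y. z y = y \<longrightarrow> g y = y) \<and> quo z g \<in> W}"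
  have "p_perm_group p S ?W" using tower_p_perm_group[OF tower.step[OF step(1-5)]] .
  then obtain k where k: "x ^^ (p ^ k) = id" using p_perm_group_funpow_id step.prems(1) by blast
  interpret commuting_pair p S x z k
    by unfold_locales (use p step k in \<open>auto simp: good_type_def\<close>)
  have reg: "regular w" for w unfolding regular_def using step.prems(3) .
  show ?case
  proof (cases "z y = y")
    case True
    thus ?thesis using step.prems(2) by auto
  next
    case False
    have yS: "y \<in> S" using False z(1) permutes_not_in by metis
    let ?r = "cyc_rep z y"
    have r: "?r \<in> moved_reps z" using cyc_rep_in_moved_reps[OF zp False] .
    have gc: "g \<circ> z = z \<circ> g" using step.prems(2) by simp
    have "quo z g ?r \<in> cyc (quo z x) ?r"
      using step.IH[of "quo z x" "quo z g"] step.prems ncyc_quo_less[OF step.prems(3)] by blast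
    hence "cyc_rep z (g y) \<in> cyc_rep z ` cyc x ?r"
      using r cyc_rep_commute[OF zp gc, of y] cyc_quo[OF r] by (simp add: quo_def)
    then obtain w where w: "w \<in> cyc x ?r" "cyc_rep z w = cyc_rep z (g y)" by auto
    have wS: "w \<in> S" using w(1) cyc_subset[OF x(1) moved_reps_in[OF r]] by blast
    have "g y \<in> cyc z w" using w cyc_rep_eq_iff[OF zp] by simp
    hence "g y \<in> cyc x w" using cyc_z_subset[OF wS reg] by blast
    also have "cyc x w = cyc x ?r" using cyc_eq[OF xp w(1)] .
    also have "?r \<in> cyc x y" using cyc_z_subset[OF yS reg] cyc_rep_in_cyc by blast
    hence "cyc x ?r = cyc x y" using cyc_eq[OF xp] by blast
    finally show ?thesis .
  qed
qed

text \<open>Equal cycles of \<open>z\<close> and \<open>z'\<close> give equal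
  \<open>moved_reps\<close> and \<open>quo\<close>, so the induction hypothesis applies to
  \<open>quo z x\<close>, which is again of good type. It remains to exchange \<open>z\<close> and
  \<open>z'\<close> in the commutation condition.\<close>

lemma tower_unique:
  assumes p: "Factorial_Ring.prime p"
  shows "tower p S W1 \<Longrightarrow> tower p S W2 \<Longrightarrow> x \<in> W1 \<Longrightarrow> x \<in> W2 \<Longrightarrow> good_type p x S \<Longrightarrow> W1 = W2"
proof (induction arbitrary: W2 x rule: tower.induct)
  case empty
  have "p_perm_group p {} W2" using tower_p_perm_group[OF empty(1)] .
  hence "W2 = {id}" using p_perm_group_permutes p_perm_group_id by fastforce
  thus ?case by simp
next
  case (step S z W)
  let ?W = "\<lambda>z W. {g. g permutes S \<and> g \<circ> z = z \<circ> g \<and> (\<forall>y. z y = y \<longrightarrow> g y = y) \<and> quo z g \<in> W}"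
  have t1: "tower p S (?W z W)" using tower.step[OF step(1-5)] .
  hence g1: "p_perm_group p S (?W z W)" using tower_p_perm_group by blast
  have g2: "p_perm_group p S W2" using tower_p_perm_group[OF step.prems(1)] .
  show ?case
  \<comment> \<open>Over the empty set either rule may have produced \<open>W2\<close>; afterwards
    only \<open>step\<close> remains.\<close>
  proof (cases "S = {}")
    case True
    hence "?W z W = {id}" using p_perm_group_permutes[OF g1] p_perm_group_id[OF g1] by fastforce
    moreover have "W2 = {id}" using p_perm_group_permutes[OF g2] p_perm_group_id[OF g2] True by fastforce
    ultimately show ?thesis by simp
  next
    case False
    from step.prems(1) obtain z' W' where z': "z' permutes S" "z' ^^ p = id" "card {y \<in> S. z' y = y} < p"
      "tower p (moved_reps z') W'" "W2 = ?W z' W'"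
      using False by cases auto
    obtain k where k: "x ^^ (p ^ k) = id" using p_perm_group_funpow_id[OF g1 step.prems(2)] by blast
    have c1: "commuting_pair p S x z k"
      by unfold_locales (use p step k in \<open>auto\<close>)
    have c2: "commuting_pair p S x z' k"
      by unfold_locales (use p step k z' in \<open>auto\<close>)
    have eq: "cyc z y = cyc z' y" for y using commuting_pair_cyc_eq[OF c1 c2] .
    have fixeq: "z y = y \<longleftrightarrow> z' y = y" for y
      using eq[of y] card_cyc_eq_1_iff[OF commuting_pair.zp[OF c1], of y] card_cyc_eq_1_iff[OF commuting_pair.zp[OF c2], of y] by simp
    have "cyc_rep z = cyc_rep z'" unfolding cyc_rep_def using eq by simp
    hence reps: "moved_reps z = moved_reps z'" and quo: "quo z = quo z'"
      using fixeq unfolding moved_reps_def quo_def by (auto simp: fun_eq_iff)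
    have "W = W'"
      using step.IH[of W' "quo z x"] z'(4,5) reps quo step.prems commuting_pair.good_type_quo[OF c1] by simp
    have orb: "g y \<in> cyc x y" if "p \<noteq> 2" "g \<in> ?W z W \<or> g \<in> W2" for g y
    proof -
      have "ncyc x S m < p" for m using step.prems(4) that(1) unfolding good_type_def by blast
      thus ?thesis using that(2) tower_orbits[OF p t1 step.prems(2)] tower_orbits[OF p step.prems(1,3)] by blast
    qed
    have "g \<in> W2" if g: "g \<in> ?W z W" for g
    proof -
      have "g \<circ> z' = z' \<circ> g" using commuting_pair_commute[OF c1 c2, of g] g orb by blast
      thus ?thesis using g z'(5) fixeq quo \<open>W = W'\<close> by auto
    qed
    moreover have "g \<in> ?W z W" if g: "g \<in> W2" for g
    proof -
      have "g \<circ> z = z \<circ> g" using commuting_pair_commute[OF c2 c1, of g] g orb z'(5) by blast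
      thus ?thesis using g z'(5) fixeq quo \<open>W = W'\<close> by auto
    qed
    ultimately show ?thesis by blast
  qed
qed

section \<open>Cycle types and parity\<close>

lemma cyc_cong:
  assumes "\<And>w. w \<in> T \<Longrightarrow> f w = g w" "\<And>w. w \<in> T \<Longrightarrow> g w \<in> T" "y \<in> T"
  shows "cyc f y = cyc g y"
proof -
  have "(f ^^ k) y = (g ^^ k) y \<and> (g ^^ k) y \<in> T" for k
    by (induction k) (use assms in auto)
  thus ?thesis unfolding cyc_def by simp
qed

text \<open>Multiplying by this transposition cuts \<open>a\<close> out of its cycle and leaves the
  other cycles alone: the induction step for the parity formula.\<close>

lemma cyc_transpose_comp:
  assumes x: "x permutes insert a S" and "x a \<noteq> a" "y \<noteq> a"
    and fin: "finite S"
  defines "x1 \<equiv> transpose a (x a) \<circ> x"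
  shows "cyc x1 y = cyc x y - {a}"
proof -
  have inj: "inj x" using permutes_inj[OF x] .
  have x1a: "x1 a = a" unfolding x1_def by simp
  have x1p: "x1 permutes insert a S"
    unfolding x1_def using x permutes_in_image[OF x, of a]
    by (intro permutes_compose permutes_swap_id) blast+
  have inj1: "inj x1" using permutes_inj[OF x1p] .
  have step: "x1 w = (if x w = a then x a else x w)" if "w \<noteq> a" for w
    using that inj assms(2) unfolding x1_def by (auto simp: transpose_def dest: injD)
  have xp: "permutation x" using x fin permutes_permutation by blast
  show ?thesis
  proof
    have "(x1 ^^ k) y \<in> cyc x y \<and> (x1 ^^ k) y \<noteq> a" for k
    proof (induction k)
      case (Suc k)
      let ?w = "(x1 ^^ k) y"
      have eq: "cyc x ?w = cyc x y" using Suc cyc_eq[OF xp] by blast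
      have "x1 ?w = x ?w \<or> x1 ?w = x (x ?w)" using step[of ?w] Suc by auto
      moreover have "x ?w \<in> cyc x ?w" "x (x ?w) \<in> cyc x ?w"
        using funpow_in_cyc[of 2 x ?w] by (auto simp: numeral_2_eq_2)
      ultimately have "x1 ?w \<in> cyc x y" unfolding eq by metis
      moreover have "x1 ?w \<noteq> a" using Suc x1a inj1 by (metis injD)
      ultimately show ?case by simp
    qed (use assms in simp)
    thus "cyc x1 y \<subseteq> cyc x y - {a}" unfolding cyc_def[of x1] by blast
    have "(x ^^ k) y \<noteq> a \<longrightarrow> (x ^^ k) y \<in> cyc x1 y" and
      "(x ^^ k) y = a \<longrightarrow> x a \<in> cyc x1 y" for k
    proof (induction k)
      case 0
      { case 1 show ?case by simp }
      { case 2 show ?case using assms by simp }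
    next
      case (Suc k)
      let ?w = "(x ^^ k) y"
      have x1p': "permutation x1" using x1p fin permutes_permutation by blast
      { case 1
        show ?case
        proof (cases "?w = a")
          case True thus ?thesis using Suc by simp
        next
          case False
          hence "?w \<in> cyc x1 y" using Suc by simp
          hence "x1 ?w \<in> cyc x1 y" using cyc_eq[OF x1p'] by (metis apply_in_cyc)
          thus ?thesis using step[OF False] by (auto split: if_splits)
        qed }
      { case 2
        show ?case
        proof
          assume a: "(x ^^ Suc k) y = a"
          hence ne: "?w \<noteq> a" using assms(2) by auto
          hence "?w \<in> cyc x1 y" using Suc by simp
          hence "x1 ?w \<in> cyc x1 y" using cyc_eq[OF x1p'] by (metis apply_in_cyc)
          thus "x a \<in> cyc x1 y" using step[OF ne] a by simp
        qed }
    qed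
    thus "cyc x y - {a} \<subseteq> cyc x1 y" unfolding cyc_def[of x] by blast
  qed
qed

text \<open>Remove a point \<open>a\<close>. If it is fixed, the numbers of points and of cycles
  both drop by one. Otherwise one transposition detaches it, which flips the parity of the
  permutation, while the number of cycles on the remaining points is the old one.\<close>

lemma evenperm_iff_card_cyc:
  assumes "finite S" "x permutes S"
  shows "evenperm x \<longleftrightarrow> even (card S + card (cyc x ` S))"
  using assms
proof (induction S arbitrary: x rule: finite_induct)
  case empty
  thus ?case by simp
next
  case (insert a S)
  have xp: "permutation x" using insert permutes_permutation by blast
  show ?case
  proof (cases "x a = a")
    case True
    have "x permutes S" using insert.prems True by (intro permutes_superset[OF insert.prems]) auto
    hence IH: "evenperm x \<longleftrightarrow> even (card S + card (cyc x ` S))" by (rule insert.IH)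
    have "cyc x a = {a}" using True by (rule cyc_fixed)
    moreover have "{a} \<notin> cyc x ` S" using insert(2) self_in_cyc by (metis imageE singletonD)
    ultimately have "card (cyc x ` insert a S) = Suc (card (cyc x ` S))"
      using insert(1) by simp
    thus ?thesis using IH insert(1,2) by simp
  next
    case False
    define x1 where "x1 = transpose a (x a) \<circ> x"
    have "x1 permutes insert a S" unfolding x1_def
      using insert.prems permutes_in_image[OF insert.prems, of a]
      by (intro permutes_compose permutes_swap_id) blast+
    moreover have "x1 a = a" unfolding x1_def by simp
    ultimately have "x1 permutes S" by (elim permutes_superset) auto
    hence IH: "evenperm x1 \<longleftrightarrow> even (card S + card (cyc x1 ` S))" by (rule insert.IH)
    have ev: "evenperm x1 \<longleftrightarrow> \<not> evenperm x"
      unfolding x1_def using evenperm_comp[OF permutation_swap_id xp] False by (auto simp: evenperm_swap)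
    have cyc1: "cyc x1 y = cyc x y - {a}" if "y \<in> S" for y
      unfolding x1_def using cyc_transpose_comp[OF insert.prems False _ insert(1), of y] that insert(2) by fastforce
    have "card (cyc x1 ` S) = card ((\<lambda>A. A - {a}) ` cyc x ` S)"
      using cyc1 by (simp add: image_image cong: image_cong)
    \<comment> \<open>No two cycles collapse when \<open>a\<close> is removed, since each retains a
      point of \<open>S\<close>.\<close>
    also have "\<dots> = card (cyc x ` S)"
    proof (intro card_image inj_onI)
      fix A B assume "A \<in> cyc x ` S" "B \<in> cyc x ` S" and AB: "A - {a} = B - {a}"
      then obtain y w where yw: "y \<in> S" "w \<in> S" "A = cyc x y" "B = cyc x w" by blast
      have "y \<in> A - {a}" using yw insert(2) by auto
      hence "y \<in> cyc x w" using AB yw by blast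
      thus "A = B" using cyc_eq[OF xp] yw by simp
    qed
    also have "cyc x ` S = cyc x ` insert a S"
    proof -
      have "x a \<in> S" using False insert.prems by (metis insertE insertI1 permutes_in_image)
      moreover have "cyc x (x a) = cyc x a" using cyc_eq[OF xp] by simp
      ultimately show ?thesis by (metis imageI image_insert insert_absorb)
    qed
    finally have "card (cyc x1 ` S) = card (cyc x ` insert a S)" .
    moreover have "card (insert a S) = Suc (card S)" using insert(1,2) by simp
    ultimately show ?thesis using IH ev by (metis add_Suc even_Suc)
  qed
qed

lemma sum_card_cyc:
  assumes "finite S" "x permutes S"
  shows "(\<Sum>A\<in>cyc x ` S. card A) = card S"
proof -
  have xp: "permutation x" using assms permutes_permutation by blast
  have "disjoint (cyc x ` S)"
    unfolding pairwise_def disjnt_def using cyc_eq[OF xp] by blast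
  hence "card (\<Union> (cyc x ` S)) = (\<Sum>A\<in>cyc x ` S. card A)"
    by (rule card_Union_disjoint) (use finite_cyc[OF xp] in auto)
  moreover have "\<Union> (cyc x ` S) = S" using cyc_subset[OF assms(2)] by auto
  ultimately show ?thesis by simp
qed

lemma permutation_with_cycle_type:
  assumes "finite S" "sum_list ls = card S" "\<And>l. l \<in> set ls \<Longrightarrow> l > 0"
  shows "\<exists>x. x permutes S \<and> image_mset card (mset_set (cyc x ` S)) = mset ls"
  using assms
proof (induction ls arbitrary: S)
  case Nil
  hence "S = {}" by simp
  thus ?case by (intro exI[of _ id] conjI permutes_id) simp
next
  case (Cons l ls)
  have "l \<le> card S" using Cons.prems by simp
  then obtain C where C: "C \<subseteq> S" "card C = l" "finite C" by (metis obtain_subset_with_card_n)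
  let ?T = "S - C"
  have "card ?T = sum_list ls" using C Cons.prems by (simp add: card_Diff_subset)
  then obtain x1 where x1: "x1 permutes ?T" "image_mset card (mset_set (cyc x1 ` ?T)) = mset ls"
    using Cons.IH[of ?T] Cons.prems by auto
  obtain c where c: "c permutes C" "\<And>y. y \<in> C \<Longrightarrow> cyc c y = C"
    using cyclic_permutation_exists[OF C(3)] by blast
  let ?x = "c \<circ> x1"
  have xS: "?x permutes S"
    using x1(1) c(1) C(1) by (intro permutes_compose) (auto intro: permutes_subset)
  have 1: "cyc ?x y = C" if "y \<in> C" for y
  proof -
    have "cyc ?x y = cyc c y"
      using that x1(1) c(1) by (intro cyc_cong[of C]) (auto simp: permutes_not_in permutes_in_image)
    thus ?thesis using c(2) that by simp
  qed
  have 2: "cyc ?x y = cyc x1 y" if y: "y \<in> ?T" for y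
  proof (rule cyc_cong[OF _ _ y])
    fix w assume w: "w \<in> ?T"
    show "x1 w \<in> ?T" using w permutes_in_image[OF x1(1)] by blast
    thus "?x w = x1 w" using c(1) by (simp add: permutes_not_in)
  qed
  have "C \<noteq> {}" using C(2) Cons.prems(3)[of l] by auto
  have "cyc ?x ` S = cyc ?x ` C \<union> cyc ?x ` ?T" using C(1) by blast
  also have "cyc ?x ` C = {C}" using 1 \<open>C \<noteq> {}\<close> by auto
  also have "cyc ?x ` ?T = cyc x1 ` ?T" using 2 by simp
  finally have im: "cyc ?x ` S = insert C (cyc x1 ` ?T)" by (metis insert_is_Un)
  have "C \<notin> cyc x1 ` ?T"
  proof
    assume "C \<in> cyc x1 ` ?T"
    then obtain y where "y \<in> ?T" "C = cyc x1 y" by blast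
    thus False using self_in_cyc[of y x1] by blast
  qed
  hence "image_mset card (mset_set (cyc ?x ` S)) = mset (l # ls)"
    using im x1(2) C(2) Cons.prems(1) by simp
  thus ?case using xS by blast
qed

text \<open>The multiplicities are the base \<open>p\<close> digits of \<open>n\<close>.\<close>

lemma prime_power_partition:
  assumes p: "Factorial_Ring.prime p"
  shows "\<exists>ls. sum_list ls = n \<and> (\<forall>l\<in>set ls. \<exists>j. l = p ^ j) \<and> (\<forall>m. count (mset ls) m < p)"
proof (induction n rule: less_induct)
  case (less n)
  show ?case
  proof (cases "n = 0")
    case True
    thus ?thesis using p by (intro exI[of _ "[]"]) (auto simp: prime_gt_0_nat)
  next
    case False
    have "n div p < n" using False prime_gt_1_nat[OF p] by simp
    then obtain ls where ls: "sum_list ls = n div p" "\<forall>l\<in>set ls. \<exists>j. l = p ^ j" "\<And>m. count (mset ls) m < p"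
      using less by blast
    \<comment> \<open>Scaling by \<open>p\<close> leaves no part equal to 1, so the lowest digit can
      be added as ones.\<close>
    let ?ls = "map ((*) p) ls @ replicate (n mod p) 1"
    have "sum_list ?ls = n"
      using ls(1) by (simp add: sum_list_const_mult sum_list_replicate)
    moreover have "\<forall>l\<in>set ?ls. \<exists>j. l = p ^ j"
    proof
      fix l assume "l \<in> set ?ls"
      then consider k where "k \<in> set ls" "l = p * k" | "l = 1" by (auto split: if_splits)
      thus "\<exists>j. l = p ^ j" using ls(2) by cases (metis power_Suc, metis power_0)
    qed
    moreover have "count (mset ?ls) m < p" for m
    proof (cases "p dvd m")
      case True
      then obtain m' where m': "m = p * m'" by blast
      have "inj ((*) p)" using p by (auto intro!: injI simp: prime_gt_0_nat)
      hence "count (image_mset ((*) p) (mset ls)) m = count (mset ls) m'"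
        unfolding m' by (induction ls) (auto dest: injD)
      moreover have "m \<noteq> 1" using True p by auto
      ultimately show ?thesis using ls(3) by (simp add: count_replicate_mset)
    next
      case False
      hence "m \<notin># image_mset ((*) p) (mset ls)" by auto
      hence "count (image_mset ((*) p) (mset ls)) m = 0" by (metis not_in_iff)
      thus ?thesis using p by (simp add: count_replicate_mset prime_gt_0_nat)
    qed
    ultimately show ?thesis by blast
  qed
qed

section \<open>Binary digits\<close>

definition bits :: "nat \<Rightarrow> nat set" where
  "bits n = {i. bin_digit n i = 1}"

lemma bits_rec: "bits n = (if odd n then {0} else {}) \<union> Suc ` bits (n div 2)"
proof -
  have "i \<in> bits n \<longleftrightarrow> i \<in> (if odd n then {0} else {}) \<union> Suc ` bits (n div 2)" for i
    by (cases i) (auto simp: bits_def bin_digit_def div_mult2_eq odd_iff_mod_2_eq_one)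
  thus ?thesis by blast
qed

lemma bits_0: "bits 0 = {}"
  by (simp add: bits_def bin_digit_def)

lemma finite_bits: "finite (bits n)"
proof (induction n rule: less_induct)
  case (less n)
  show ?case
    by (cases "n = 0") (use less[of "n div 2"] bits_rec[of n] in \<open>auto simp: bits_0\<close>)
qed

lemma card_bits_rec: "card (bits n) = n mod 2 + card (bits (n div 2))"
proof -
  have "card (bits n) = card (if odd n then {0::nat} else {}) + card (Suc ` bits (n div 2))"
    unfolding bits_rec[of n] by (rule card_Un_disjoint) (auto simp: finite_bits)
  thus ?thesis by (auto simp: card_image odd_iff_mod_2_eq_one)
qed

lemma bits_nonempty: "n > 0 \<Longrightarrow> bits n \<noteq> {}"
proof (induction n rule: less_induct)
  case (less n)
  show ?case
  proof (cases "odd n")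
    case False
    hence "n div 2 < n" "n div 2 > 0" using less.prems by auto
    thus ?thesis using less.IH bits_rec[of n] by blast
  qed (use bits_rec[of n] in simp)
qed

text \<open>Used to count cycles whose lengths are distinct powers of 2. In the induction the
  largest exponent comes last, because its power exceeds the sum of all the others.\<close>

lemma card_bits_sum_powers:
  assumes "finite J"
  shows "card (bits (\<Sum>j\<in>J. 2 ^ j)) = card J"
  using assms
proof (induction rule: finite_linorder_max_induct)
  case empty
  show ?case by (simp add: bits_0)
next
  case (insert k J)
  have add: "card (bits (2 ^ k + m)) = Suc (card (bits m))" if "m < 2 ^ k" for k m
    using that
  proof (induction k arbitrary: m)
    case 0
    thus ?case using card_bits_rec[of 1] by (simp add: bits_0)
  next
    case (Suc k)
    have "card (bits (2 ^ k + m div 2)) = Suc (card (bits (m div 2)))" using Suc by (intro Suc.IH) auto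
    thus ?case using card_bits_rec[of "2 ^ Suc k + m"] card_bits_rec[of m] by simp
  qed
  have "J \<subseteq> {..<k}" using insert by auto
  hence "(\<Sum>j\<in>J. 2 ^ j) \<le> (\<Sum>j<k. 2 ^ j :: nat)" by (intro sum_mono2) auto
  also have "\<dots> < 2 ^ k" by (simp add: sum_power2 lessThan_atLeast0)
  finally show ?case using add insert by auto
qed

lemma bin_low_rec:
  assumes "n > 0"
  shows "bin_low n = (if odd n then 0 else Suc (bin_low (n div 2)))"
proof (cases "odd n")
  case True
  hence "0 \<in> bits n" using bits_rec[of n] by simp
  thus ?thesis using True finite_bits[of n] unfolding bin_low_def bits_def[symmetric]
    by (metis Min_le bot_nat_0.extremum_uniqueI)
next
  case False
  have "bits n = Suc ` bits (n div 2)" using False bits_rec[of n] by simp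
  moreover have "bits (n div 2) \<noteq> {}" using assms False by (intro bits_nonempty) auto
  ultimately show ?thesis using False unfolding bin_low_def bits_def[symmetric]
    by (simp add: mono_Min_commute[of Suc] finite_bits mono_Suc)
qed

text \<open>Subtracting 1 turns the final block 1 0...0, which has \<open>bin_low n\<close> zeros,
  into 0 1...1.\<close>

lemma card_bits_pred:
  assumes "n > 0" "even n"
  shows "card (bits (n - 1)) + 1 = card (bits n) + bin_low n"
  using assms
proof (induction n rule: less_induct)
  case (less n)
  then obtain m where m: "n = 2 * m" "m > 0" by auto
  have 1: "card (bits (n - 1)) = 1 + card (bits (m - 1))"
  proof -
    have "n - 1 = 2 * (m - 1) + 1" using m by simp
    hence "(n - 1) mod 2 = 1" "(n - 1) div 2 = m - 1" by presburger+
    thus ?thesis using card_bits_rec[of "n - 1"] by simp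
  qed
  have 2: "card (bits n) = card (bits m)" "bin_low n = Suc (bin_low m)"
    using card_bits_rec[of n] bin_low_rec[of n] m by auto
  show ?case
  proof (cases "even m")
    case True
    thus ?thesis using less.IH[of m] m 1 2 by simp
  next
    case False
    have "(m - 1) div 2 = m div 2" "(m - 1) mod 2 = 0" "m mod 2 = 1" using False by presburger+
    hence "card (bits m) = 1 + card (bits (m - 1))"
      using card_bits_rec[of m] card_bits_rec[of "m - 1"] by simp
    thus ?thesis using 1 2 bin_low_rec[of m] m False by simp
  qed
qed

lemma sum_bin_digit:
  assumes "finite T"
  shows "(\<Sum>i\<in>T. bin_digit n i) = card (bits n \<inter> T)"
proof -
  have "bin_digit n i = (if i \<in> bits n then 1 else 0)" for i
    unfolding bits_def bin_digit_def by auto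
  hence "(\<Sum>i\<in>T. bin_digit n i) = (\<Sum>i\<in>T. if i \<in> bits n then 1 else 0)" by simp
  thus ?thesis using assms by (simp add: sum.inter_restrict[symmetric] Int_commute)
qed

lemma sum_bin_digit_all:
  assumes "n > 0"
  shows "(\<Sum>i\<in>{bin_low n..bin_high n}. bin_digit n i) = card (bits n)"
proof -
  have "bits n \<subseteq> {bin_low n..bin_high n}"
    using finite_bits[of n] unfolding bin_low_def bin_high_def bits_def[symmetric] by auto
  thus ?thesis by (simp add: sum_bin_digit Int_absorb2)
qed

lemma sum_bin_digit_odd:
  assumes "odd n"
  shows "Suc (\<Sum>i\<in>{1..bin_high n}. bin_digit n i) = card (bits n)"
proof -
  have "bits n \<inter> {1..bin_high n} = bits n - {0}"
    using finite_bits[of n] unfolding bin_high_def bits_def[symmetric] by (auto simp: Suc_le_eq)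
  moreover have "0 \<in> bits n" using assms bits_rec[of n] by simp
  ultimately show ?thesis using card.remove[OF finite_bits, of 0 n] by (simp add: sum_bin_digit)
qed

text \<open>The first conjunct makes permutations with distinct 2-power cycle lengths odd; given it,
  the second does the same for two fixed points. For odd \<open>n\<close> the original sum omits the
  digit 1 at position 0, which accounts for the term \<open>n\<close>; for even \<open>n\<close> the
  lowest position is positive, so being even makes it at least 2.\<close>

lemma alt_redundant_cond_iff:
  assumes "n > 0"
  shows "alt_redundant_cond n \<longleftrightarrow>
    odd (n + card (bits n)) \<and> (even n \<longrightarrow> even (bin_low n))"
proof (cases "odd n")
  case True
  thus ?thesis using sum_bin_digit_odd[OF True] unfolding alt_redundant_cond_def by (metis even_Suc even_add)
next
  case False
  hence "bin_low n \<ge> 1" using bin_low_rec[OF assms] by simp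
  hence "even (bin_low n) \<Longrightarrow> bin_low n \<ge> 2" by (metis One_nat_def Suc_leI le_neq_implies_less odd_one numeral_2_eq_2)
  thus ?thesis using False sum_bin_digit_all[OF assms] unfolding alt_redundant_cond_def by auto
qed

section \<open>Permutations in several Sylow 2-subgroups\<close>

lemma involution_permutes:
  assumes "f \<circ> f = id" "\<And>y. y \<notin> Y \<Longrightarrow> f y = y"
  shows "f permutes Y"
proof -
  have "bij f" using o_bij[OF assms(1,1)] .
  thus ?thesis using assms(2) unfolding permutes_def bij_iff by blast
qed

lemma disjoint_permutes_commute:
  assumes a: "a permutes A" and b: "b permutes B" and "A \<inter> B = {}"
  shows "a \<circ> b = b \<circ> a"
proof
  fix y
  consider "y \<in> A" "y \<notin> B" | "y \<in> B" "y \<notin> A" | "y \<notin> A" "y \<notin> B" using assms(3) by blast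
  thus "(a \<circ> b) y = (b \<circ> a) y"
  proof cases
    case 1
    hence "a y \<notin> B" using permutes_in_image[OF a, of y] assms(3) by blast
    thus ?thesis using 1 b by (simp add: permutes_not_in)
  next
    case 2
    hence "b y \<notin> A" using permutes_in_image[OF b, of y] assms(3) by blast
    thus ?thesis using 2 a by (simp add: permutes_not_in)
  next
    case 3
    thus ?thesis using a b by (simp add: permutes_not_in)
  qed
qed

lemma funpow_restrict_id:
  assumes "\<And>y. y \<in> A \<Longrightarrow> f y \<in> A"
  shows "restrict_id f A ^^ k = restrict_id (f ^^ k) A"
proof
  fix y show "(restrict_id f A ^^ k) y = restrict_id (f ^^ k) A y"
  proof (cases "y \<in> A")
    case True
    have "(restrict_id f A ^^ k) y = (f ^^ k) y \<and> (f ^^ k) y \<in> A"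
      by (induction k) (use True assms in auto)
    thus ?thesis using True by simp
  next
    case False
    thus ?thesis by (simp add: funpow_fixed)
  qed
qed

lemma restrict_id_commute:
  assumes "\<And>y. y \<in> A \<longleftrightarrow> x y \<in> A"
  shows "x \<circ> restrict_id (x ^^ k) A = restrict_id (x ^^ k) A \<circ> x"
  using assms by (auto simp: fun_eq_iff restrict_id_def funpow_swap1)

text \<open>These permutations act on the cycles of \<open>w\<close> like a power of
  \<open>x\<close>. Those acting trivially there send each \<open>y\<close> to \<open>y\<close> or
  \<open>w y\<close> and square to the identity, so all orders are powers of 2. This admits a
  \<open>t\<close> that does not commute with \<open>x\<close>: it is enough that \<open>w\<close>
  does.\<close>

lemma involution_extension_group:
  assumes x: "x permutes S" "x ^^ (2 ^ k) = id" and w: "w permutes S" "w \<circ> w = id" and xw: "x \<circ> w = w \<circ> x"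
  shows "p_perm_group 2 S {g. g permutes S \<and> (\<exists>i. \<forall>y. g y = (x ^^ i) y \<or> g y = w ((x ^^ i) y))}"
    (is "p_perm_group 2 S ?P")
proof -
  have ww: "w (w y) = y" for y using fun_cong[OF w(2), of y] by simp
  have wx: "(x ^^ i) (w y) = w ((x ^^ i) y)" for i y
    using funpow_commute1[OF xw[symmetric], of i y] by simp
  let ?R = "\<lambda>g i. \<forall>y. g y = (x ^^ i) y \<or> g y = w ((x ^^ i) y)"
  have comp: "?R (g \<circ> h) (i + j)" if g: "?R g i" and h: "?R h j" for g h i j
  proof
    fix y
    have "h y = (x ^^ j) y \<or> h y = w ((x ^^ j) y)" using h by simp
    moreover have "g (h y) = (x ^^ i) (h y) \<or> g (h y) = w ((x ^^ i) (h y))" using g by simp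
    ultimately show "(g \<circ> h) y = (x ^^ (i + j)) y \<or> (g \<circ> h) y = w ((x ^^ (i + j)) y)"
      by (auto simp: funpow_add wx ww)
  qed
  have pow: "?R (g ^^ n) (n * i)" if g: "?R g i" for g i n
  proof (induction n)
    case (Suc n)
    show ?case using comp[OF g Suc] by (simp add: funpow_add)
  qed simp
  show ?thesis unfolding p_perm_group_def
  proof (intro conjI ballI)
    show "id \<in> ?P" by (auto intro: exI[of _ 0])
    fix g assume g: "g \<in> ?P"
    then obtain i where i: "?R g i" and gS: "g permutes S" by blast
    show "g permutes S" by fact
    have inj: "inj (g ^^ (2 ^ k))" using permutes_inj[OF permutes_funpow[OF gS]] .
    define h where "h = g ^^ (2 ^ k)"
    have "x ^^ (2 ^ k * i) = id" using funpow_dvd_id[OF x(2)] by simp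
    hence h: "h y = y \<or> h y = w y" for y using pow[OF i, of "2 ^ k"] unfolding h_def by auto
    have "h (h y) = y" for y
    proof (cases "h y = y")
      case False
      hence hy: "h y = w y" using h by blast
      have "h (w y) \<noteq> w y" using False hy inj unfolding h_def by (metis injD)
      hence "h (w y) = y" using h[of "w y"] ww by simp
      thus ?thesis using hy by simp
    qed simp
    hence "h \<circ> h = id" by auto
    moreover have "g ^^ (2 ^ Suc k) = h \<circ> h" unfolding h_def by (simp add: funpow_add[symmetric] mult_2)
    ultimately show "\<exists>k. g ^^ (2 ^ k) = id" by metis
    fix h assume h: "h \<in> ?P"
    then obtain j where "?R h j" and hS: "h permutes S" by blast
    thus "g \<circ> h \<in> ?P" using comp[OF i] permutes_compose[OF hS gS] by blast
  qed
qed

lemma involution_extension_mem: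
  assumes "x permutes S"
  shows "x \<in> {g. g permutes S \<and> (\<exists>i. \<forall>y. g y = (x ^^ i) y \<or> g y = w ((x ^^ i) y))}"
    and "t permutes S \<Longrightarrow> (\<And>y. t y = y \<or> t y = w y) \<Longrightarrow>
      t \<in> {g. g permutes S \<and> (\<exists>i. \<forall>y. g y = (x ^^ i) y \<or> g y = w ((x ^^ i) y))}"
proof -
  have "\<forall>y. x y = (x ^^ 1) y \<or> x y = w ((x ^^ 1) y)" by simp
  thus "x \<in> {g. g permutes S \<and> (\<exists>i. \<forall>y. g y = (x ^^ i) y \<or> g y = w ((x ^^ i) y))}"
    using assms by blast
  assume "t permutes S" "\<And>y. t y = y \<or> t y = w y"
  moreover from this(2) have "\<forall>y. t y = (x ^^ 0) y \<or> t y = w ((x ^^ 0) y)" by simp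
  ultimately show "t \<in> {g. g permutes S \<and> (\<exists>i. \<forall>y. g y = (x ^^ i) y \<or> g y = w ((x ^^ i) y))}"
    by blast
qed

lemma transpose_fixed_commute:
  assumes "inj x" "x d = d" "x e = e"
  shows "x \<circ> transpose d e = transpose d e \<circ> x"
proof
  fix y
  have "x y = d \<longleftrightarrow> y = d" "x y = e \<longleftrightarrow> y = e" using assms by (metis injD)+
  thus "(x \<circ> transpose d e) y = (transpose d e \<circ> x) y" using assms(2,3) by (simp add: transpose_def)
qed

text \<open>If \<open>x\<close> is trivial on \<open>Z\<close>, a transposition will do; otherwise
  take the last nontrivial one among the repeated squares of the restriction of
  \<open>x\<close>.\<close>

lemma commuting_involution_exists:
  assumes fin: "finite S" and x: "x permutes S" "x ^^ (2 ^ k) = id"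
    and Z: "Z \<subseteq> S" "\<And>y. y \<in> Z \<longleftrightarrow> x y \<in> Z" "card Z \<ge> 2"
  shows "\<exists>w. w permutes Z \<and> w \<circ> w = id \<and> x \<circ> w = w \<circ> x \<and> w \<noteq> id"
proof (cases "\<forall>y\<in>Z. x y = y")
  case True
  obtain T where T: "T \<subseteq> Z" "card T = 2" using Z(3) by (metis obtain_subset_with_card_n)
  then obtain d e where de: "d \<in> Z" "e \<in> Z" "d \<noteq> e" by (auto simp: card_2_iff)
  have "x \<circ> transpose d e = transpose d e \<circ> x"
    using True de by (intro transpose_fixed_commute permutes_inj[OF x(1)]) auto
  moreover have "transpose d e \<noteq> id" using de by (metis id_apply transpose_apply_first)
  ultimately show ?thesis
    using permutes_swap_id[OF de(1,2)] by (intro exI[of _ "transpose d e"]) (auto simp: fun_eq_iff)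
next
  case False
  define r where "r = restrict_id x Z"
  have pow: "r ^^ i = restrict_id (x ^^ i) Z" for i
    unfolding r_def using Z(2) by (intro funpow_restrict_id) auto
  have "r ^^ (2 ^ k) = id" unfolding pow x(2) by (auto simp: restrict_id_def)
  define j where "j = (LEAST j. r ^^ (2 ^ j) = id)"
  have j: "r ^^ (2 ^ j) = id" unfolding j_def using \<open>r ^^ (2 ^ k) = id\<close> by (rule LeastI)
  have "r \<noteq> id" using False unfolding r_def by (metis id_apply restrict_id_simps(1))
  hence "j \<noteq> 0" using j by (intro notI) simp
  then obtain i where i: "j = Suc i" by (cases j) auto
  have ne: "r ^^ (2 ^ i) \<noteq> id"
  proof
    assume "r ^^ (2 ^ i) = id"
    hence "j \<le> i" unfolding j_def by (rule Least_le)
    thus False using i by simp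
  qed
  have inv: "r ^^ (2 ^ i) \<circ> r ^^ (2 ^ i) = id" using j i by (simp add: funpow_add[symmetric] mult_2)
  moreover have "r ^^ (2 ^ i) permutes Z"
    by (rule involution_permutes[OF inv]) (simp add: pow)
  moreover have "x \<circ> r ^^ (2 ^ i) = r ^^ (2 ^ i) \<circ> x"
    unfolding pow using Z(2) by (rule restrict_id_commute)
  ultimately show ?thesis using ne by blast
qed

text \<open>If \<open>t\<close> and \<open>u\<close> are odd, both are multiplied by one transposition \<open>s\<close> outside \<open>Y\<close>, taken from an involution
  commuting with \<open>x\<close>; this leaves the product unchanged.\<close>

lemma even_2_group_pair:
  assumes fin: "finite S" and x: "x permutes S" "x ^^ (2 ^ k) = id"
    and Y: "Y \<subseteq> S" "\<And>y. y \<in> Y \<longleftrightarrow> x y \<in> Y"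
    and w1: "w1 permutes Y" "w1 \<circ> w1 = id" "x \<circ> w1 = w1 \<circ> x"
    and w2: "w2 permutes Y" "w2 \<circ> w2 = id" "x \<circ> w2 = w2 \<circ> x"
    and t: "t permutes Y" "\<And>y. t y = y \<or> t y = w1 y"
    and u: "u permutes Y" "\<And>y. u y = y \<or> u y = w2 y"
    and tu: "(t \<circ> u) ^^ 3 = id" "t \<circ> u \<noteq> id"
    and ev: "evenperm t \<or> card (S - Y) \<ge> 2"
  shows "\<exists>P Q t u. p_perm_group 2 S P \<and> p_perm_group 2 S Q \<and> x \<in> P \<and> x \<in> Q \<and> t \<in> P \<and> u \<in> Q \<and>
    evenperm t \<and> evenperm u \<and> (t \<circ> u) ^^ 3 = id \<and> t \<circ> u \<noteq> id"
proof -
  have finY: "finite Y" using Y fin finite_subset by blast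
  have tp: "permutation t" and up: "permutation u" using t u finY permutes_permutation by auto
  \<comment> \<open>A permutation with trivial cube is even, so \<open>t\<close> and
    \<open>u\<close> have the same parity and one correction serves both.\<close>
  have "evenperm ((t \<circ> u) ^^ 3) \<longleftrightarrow> evenperm (t \<circ> u)"
  proof -
    let ?v = "t \<circ> u"
    have vp: "permutation ?v" using permutation_compose[OF tp up] .
    have "?v ^^ 3 = ?v \<circ> (?v \<circ> ?v)" by (metis funpow_simps_right(1) funpow.simps(2) numeral_3_eq_3 comp_id)
    thus ?thesis using evenperm_comp[OF vp permutation_compose[OF vp vp]] evenperm_comp[OF vp vp] by simp
  qed
  hence evu: "evenperm t \<longleftrightarrow> evenperm u" using tu(1) evenperm_comp[OF tp up] by simp
  have main: "\<exists>P Q t u. p_perm_group 2 S P \<and> p_perm_group 2 S Q \<and> x \<in> P \<and> x \<in> Q \<and> t \<in> P \<and> u \<in> Q \<and>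
      evenperm t \<and> evenperm u \<and> (t \<circ> u) ^^ 3 = id \<and> t \<circ> u \<noteq> id"
    if a: "a permutes S" "a \<circ> a = id" "x \<circ> a = a \<circ> x" and b: "b permutes S" "b \<circ> b = id" "x \<circ> b = b \<circ> x"
      and t': "t' permutes S" "\<And>y. t' y = y \<or> t' y = a y" and u': "u' permutes S" "\<And>y. u' y = y \<or> u' y = b y"
      and e: "evenperm t'" "evenperm u'" and c: "t' \<circ> u' = t \<circ> u" for a b t' u'
    using involution_extension_group[OF x a] involution_extension_group[OF x b]
      involution_extension_mem(1)[OF x(1), of a] involution_extension_mem(1)[OF x(1), of b]
      involution_extension_mem(2)[OF x(1) t'] involution_extension_mem(2)[OF x(1) u'] e tu[folded c] by blast
  show ?thesis
  proof (cases "evenperm t")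
    case True
    thus ?thesis using main[of w1 w2 t u] w1 w2 t u evu permutes_subset[OF _ Y(1)] by blast
  next
    case False
    let ?Z = "S - Y"
    have ZS: "y \<in> ?Z \<longleftrightarrow> x y \<in> ?Z" for y using Y(2) permutes_in_image[OF x(1)] by blast
    obtain w0 where w0: "w0 permutes ?Z" "w0 \<circ> w0 = id" "x \<circ> w0 = w0 \<circ> x" "w0 \<noteq> id"
      using commuting_involution_exists[OF fin x _ ZS] ev False by blast
    obtain d where d: "w0 d \<noteq> d" using w0(4) by fastforce
    have dZ: "d \<in> ?Z" using d w0(1) permutes_not_in by metis
    have w0dZ: "w0 d \<in> ?Z" using dZ permutes_in_image[OF w0(1)] by blast
    have w0w0: "w0 (w0 y) = y" for y using fun_cong[OF w0(2), of y] by simp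
    \<comment> \<open>A single transposition taken from \<open>w0\<close> is odd whatever the parity
      of \<open>w0\<close>. It agrees at each point with \<open>w0\<close> or the identity, so
      commutation with \<open>x\<close> is required of \<open>w0\<close> alone.\<close>
    define s where "s = transpose d (w0 d)"
    have s: "s permutes ?Z" unfolding s_def using dZ w0dZ by (rule permutes_swap_id)
    have sval: "s y = y \<or> s y = w0 y" for y unfolding s_def transpose_def using w0w0 by auto
    have ss: "s \<circ> s = id" unfolding s_def by simp
    have sp: "permutation s" and sodd: "\<not> evenperm s"
      unfolding s_def using d by (auto simp: permutation_swap_id evenperm_swap)
    have disj: "Y \<inter> ?Z = {}" by blast
    have ext: "(w \<circ> w0) permutes S" "(w \<circ> w0) \<circ> (w \<circ> w0) = id" "x \<circ> (w \<circ> w0) = (w \<circ> w0) \<circ> x"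
      if w: "w permutes Y" "w \<circ> w = id" "x \<circ> w = w \<circ> x" for w
    proof -
      show "w \<circ> w0 permutes S"
        using permutes_subset[OF w(1) Y(1)] permutes_subset[OF w0(1), of S] by (intro permutes_compose) auto
      have "w \<circ> w0 = w0 \<circ> w" using disjoint_permutes_commute[OF w(1) w0(1) disj] .
      thus "(w \<circ> w0) \<circ> (w \<circ> w0) = id" using w(2) w0(2) by (metis comp_assoc comp_id)
      show "x \<circ> (w \<circ> w0) = (w \<circ> w0) \<circ> x" using w(3) w0(3) by (metis comp_assoc)
    qed
    have val: "(f \<circ> s) y = y \<or> (f \<circ> s) y = (w \<circ> w0) y"
      if w: "w permutes Y" and f: "f permutes Y" "\<And>y. f y = y \<or> f y = w y" for f w y
    proof (cases "y \<in> Y")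
      case True
      hence "s y = y" "w0 y = y" using s w0(1) permutes_not_in by (metis DiffE)+
      thus ?thesis using f(2)[of y] by simp
    next
      case False
      have "s y \<notin> Y"
        using False permutes_in_image[OF s, of y] permutes_not_in[OF s, of y] by (cases "y \<in> ?Z") auto
      moreover have "w0 y \<notin> Y"
        using False permutes_in_image[OF w0(1), of y] permutes_not_in[OF w0(1), of y] by (cases "y \<in> ?Z") auto
      ultimately show ?thesis using sval[of y] f(1) w by (simp add: permutes_not_in)
    qed
    have perm: "f \<circ> s permutes S" if "f permutes Y" for f
      using permutes_subset[OF that Y(1)] permutes_subset[OF s, of S] by (intro permutes_compose) auto
    have "(t \<circ> s) \<circ> (u \<circ> s) = t \<circ> u"
    proof -
      have "s \<circ> (u \<circ> s) = u" using disjoint_permutes_commute[OF u(1) s disj] ss by (metis comp_assoc comp_id)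
      thus ?thesis by (metis comp_assoc)
    qed
    moreover have "evenperm (t \<circ> s)" "evenperm (u \<circ> s)"
      using evenperm_comp[OF tp sp] evenperm_comp[OF up sp] sodd False evu by auto
    ultimately show ?thesis
      by (intro main[OF ext[OF w1] ext[OF w2] perm[OF t(1)] val[OF w1(1) t] perm[OF u(1)] val[OF w2(1) u]])
  qed
qed

lemma funpow_eq_iff_mod:
  assumes "permutation x"
  shows "(x ^^ i) y = (x ^^ j) y \<longleftrightarrow> i mod card (cyc x y) = j mod card (cyc x y)"
proof -
  have 1: "(x ^^ i) y = (x ^^ j) y \<longleftrightarrow> i mod card (cyc x y) = j mod card (cyc x y)" if "i \<le> j" for i j
  proof -
    have inj: "inj (x ^^ i)" using permutation_bijective[OF permutation_funpow[OF assms]] bij_is_inj by blast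
    have "(x ^^ j) y = (x ^^ i) ((x ^^ (j - i)) y)" using that by (metis comp_apply funpow_add le_add_diff_inverse)
    hence "(x ^^ i) y = (x ^^ j) y \<longleftrightarrow> (x ^^ (j - i)) y = y" using inj by (metis inj_eq)
    also have "\<dots> \<longleftrightarrow> card (cyc x y) dvd (j - i)" by (rule funpow_eq_self_iff[OF assms])
    also have "\<dots> \<longleftrightarrow> i mod card (cyc x y) = j mod card (cyc x y)"
      using that by (metis mod_eq_dvd_iff_nat)
    finally show ?thesis .
  qed
  show ?thesis using 1[of i j] 1[of j i] by (cases "i \<le> j") auto
qed

text \<open>The transpositions of \<open>a\<close>, \<open>b\<close> and of \<open>b\<close>,
  \<open>c\<close> commute with \<open>x\<close>, and their product is a 3-cycle. Both are odd, and
  the other points, at least three, make room for the correction.\<close>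

lemma even_2_group_pair_three_fixed:
  assumes fin: "finite S" and x: "x permutes S" "x ^^ (2 ^ k) = id" and "card S \<ge> 6"
    and abc: "a \<in> S" "b \<in> S" "c \<in> S" "a \<noteq> b" "b \<noteq> c" "a \<noteq> c" "x a = a" "x b = b" "x c = c"
  shows "\<exists>P Q t u. p_perm_group 2 S P \<and> p_perm_group 2 S Q \<and> x \<in> P \<and> x \<in> Q \<and> t \<in> P \<and> u \<in> Q \<and>
    evenperm t \<and> evenperm u \<and> (t \<circ> u) ^^ 3 = id \<and> t \<circ> u \<noteq> id"
proof -
  let ?Y = "{a, b, c}"
  have inj: "inj x" using permutes_inj[OF x(1)] .
  note comm = transpose_fixed_commute[OF inj]
  show ?thesis
  proof (rule even_2_group_pair[OF fin x, of ?Y "transpose a b" "transpose b c" "transpose a b" "transpose b c"])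
    have "x y = a \<longleftrightarrow> y = a" "x y = b \<longleftrightarrow> y = b" "x y = c \<longleftrightarrow> y = c" for y
      using abc inj by (metis injD)+
    thus "y \<in> ?Y \<longleftrightarrow> x y \<in> ?Y" for y by simp
    show "(transpose a b \<circ> transpose b c) ^^ 3 = id"
      using abc by (auto simp: fun_eq_iff numeral_3_eq_3 transpose_def)
    show "transpose a b \<circ> transpose b c \<noteq> id"
    proof
      assume "transpose a b \<circ> transpose b c = id"
      hence "transpose a b (transpose b c c) = c" by (metis comp_apply id_apply)
      thus False using abc by (simp add: transpose_def)
    qed
    have "card (S - ?Y) = card S - 3" using abc by (subst card_Diff_subset) auto
    hence "2 \<le> card (S - ?Y)" using assms(4) by linarith
    thus "evenperm (transpose a b) \<or> 2 \<le> card (S - ?Y)" ..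
  qed (use abc comm in \<open>auto intro: permutes_swap_id\<close>)
qed

text \<open>With \<open>m = 2 h\<close>, \<open>t\<close> swaps \<open>e1 i\<close> and \<open>e1 (i + h)\<close>, and \<open>u\<close> swaps \<open>e1 i\<close> and \<open>e2 i\<close> for \<open>i < h\<close> only, so
  \<open>t \<circ> u\<close> is a product of the \<open>3\<close>-cycles on \<open>e1 i\<close>, \<open>e2 i\<close>, \<open>e1 (i + h)\<close>.\<close>

lemma even_2_group_pair_two_cycles:
  assumes fin: "finite S" and x: "x permutes S" "x ^^ (2 ^ k) = id" and S6: "card S \<ge> 6"
    and y12: "y1 \<in> S" "y2 \<in> S" "cyc x y1 \<noteq> cyc x y2" and m: "card (cyc x y1) = m" "card (cyc x y2) = m" "m \<ge> 2"
  shows "\<exists>P Q t u. p_perm_group 2 S P \<and> p_perm_group 2 S Q \<and> x \<in> P \<and> x \<in> Q \<and> t \<in> P \<and> u \<in> Q \<and>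
    evenperm t \<and> evenperm u \<and> (t \<circ> u) ^^ 3 = id \<and> t \<circ> u \<noteq> id"
proof -
  have xp: "permutation x" using x fin permutes_permutation by blast
  obtain j where j: "m = 2 ^ j"
    using card_cyc_prime_power[OF xp two_is_prime_nat x(2), of y1] m by auto
  have "j \<noteq> 0" using j m by (intro notI) simp
  then obtain i0 where i0: "j = Suc i0" by (cases j) auto
  define h where "h = (2 ^ i0 :: nat)"
  have mh: "m = h + h" and h0: "h > 0" unfolding h_def j i0 by auto
  define A where "A = cyc x y1"
  define B where "B = cyc x y2"
  have AB: "A \<inter> B = {}" unfolding A_def B_def using cyc_eq[OF xp] y12(3) by blast
  define e1 where "e1 i = (x ^^ i) y1" for i
  define e2 where "e2 i = (x ^^ i) y2" for i
  have e1_eq: "e1 i = e1 i' \<longleftrightarrow> i mod m = i' mod m" and e2_eq: "e2 i = e2 i' \<longleftrightarrow> i mod m = i' mod m" for i i'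
    unfolding e1_def e2_def using funpow_eq_iff_mod[OF xp] m by auto
  have eA: "e1 i \<in> A" and eB: "e2 i \<in> B" for i unfolding e1_def e2_def A_def B_def by auto
  have ne: "e1 i \<noteq> e2 i'" for i i' using eA eB AB by (metis IntI empty_iff)
  have A_ex: "\<exists>i<m. y = e1 i" if y: "y \<in> A" for y
  proof -
    obtain i where "y = e1 i" using y unfolding A_def e1_def cyc_def by blast
    hence "y = e1 (i mod m)" using e1_eq by simp
    thus ?thesis using mh h0 by (intro exI[of _ "i mod m"]) auto
  qed
  have B_ex: "\<exists>i<m. y = e2 i" if y: "y \<in> B" for y
  proof -
    obtain i where "y = e2 i" using y unfolding B_def e2_def cyc_def by blast
    hence "y = e2 (i mod m)" using e2_eq by simp
    thus ?thesis using mh h0 by (intro exI[of _ "i mod m"]) auto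
  qed
  have xe: "x (e1 i) = e1 (Suc i)" "x (e2 i) = e2 (Suc i)" for i unfolding e1_def e2_def by auto
  have cycinv: "y \<in> cyc x v \<longleftrightarrow> x y \<in> cyc x v" for y v
    using cyc_eq_iff[OF xp] cyc_eq[OF xp apply_in_cyc] by metis
  have Ainv: "y \<in> A \<longleftrightarrow> x y \<in> A" and Binv: "y \<in> B \<longleftrightarrow> x y \<in> B" for y
    unfolding A_def B_def using cycinv by auto
  let ?Y = "A \<union> B"
  have AS: "A \<subseteq> S" and BS: "B \<subseteq> S" unfolding A_def B_def using cyc_subset[OF x(1)] y12 by auto

  define t where "t = restrict_id (x ^^ h) A"
  have t_e1: "t (e1 i) = e1 (i + h)" and t_e2: "t (e2 i) = e2 i" for i
  proof -
    show "t (e1 i) = e1 (i + h)" unfolding t_def using eA by (simp add: e1_def funpow_add[symmetric, unfolded fun_eq_iff comp_def, rule_format] add.commute)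
    have "e2 i \<notin> A" using eB AB by blast
    thus "t (e2 i) = e2 i" unfolding t_def by simp
  qed
  have t_out: "t y = y" if "y \<notin> ?Y" for y using that unfolding t_def by simp
  have tt: "t \<circ> t = id"
  proof
    fix y show "(t \<circ> t) y = id y"
    proof (cases "y \<in> A")
      case True
      then obtain i where i: "y = e1 i" using A_ex by blast
      have "e1 (i + h + h) = e1 i" using e1_eq mh by (simp add: add.assoc)
      thus ?thesis using i t_e1 by simp
    qed (simp add: t_def)
  qed
  have tperm: "t permutes ?Y" using tt t_out by (rule involution_permutes)
  have tx: "x \<circ> t = t \<circ> x" unfolding t_def using Ainv by (rule restrict_id_commute)

  \<comment> \<open>The index of a point is determined only modulo \<open>m\<close>; as both cycles
    have length \<open>m\<close>, the choice does not matter.\<close>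
  define w where "w y = (if y \<in> A then e2 (SOME i. e1 i = y) else if y \<in> B then e1 (SOME i. e2 i = y) else y)" for y
  have w_e1: "w (e1 i) = e2 i" for i
  proof -
    have "e1 (SOME i'. e1 i' = e1 i) = e1 i" by (rule someI_ex) blast
    hence "e2 (SOME i'. e1 i' = e1 i) = e2 i" using e1_eq e2_eq by blast
    thus ?thesis using eA unfolding w_def by simp
  qed
  have w_e2: "w (e2 i) = e1 i" for i
  proof -
    have "e2 (SOME i'. e2 i' = e2 i) = e2 i" by (rule someI_ex) blast
    hence "e1 (SOME i'. e2 i' = e2 i) = e1 i" using e1_eq e2_eq by blast
    moreover have "e2 i \<notin> A" using eB AB by blast
    ultimately show ?thesis using eB unfolding w_def by simp
  qed
  have w_out: "w y = y" if "y \<notin> ?Y" for y using that unfolding w_def by simp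
  have cases: thesis if "\<And>i. i < m \<Longrightarrow> y = e1 i \<Longrightarrow> thesis" "\<And>i. i < m \<Longrightarrow> y = e2 i \<Longrightarrow> thesis" "y \<notin> ?Y \<Longrightarrow> thesis" for y thesis
    using that A_ex B_ex by blast
  have ww: "w \<circ> w = id"
  proof
    fix y show "(w \<circ> w) y = id y" by (rule cases[of y]) (auto simp: w_e1 w_e2 w_out)
  qed
  have wperm: "w permutes ?Y" using ww w_out by (rule involution_permutes)
  have wx: "x \<circ> w = w \<circ> x"
  proof
    fix y show "(x \<circ> w) y = (w \<circ> x) y"
    proof (rule cases[of y])
      assume "y \<notin> ?Y"
      moreover hence "x y \<notin> ?Y" using Ainv Binv by blast
      ultimately show ?thesis by (simp add: w_out)
    qed (auto simp: w_e1 w_e2 xe)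
  qed

  \<comment> \<open>With all of \<open>w\<close> the product with \<open>t\<close> would consist of
    4-cycles; keeping only the first halves fixes \<open>e2 (i + h)\<close> and leaves
    3-cycles.\<close>
  define H where "H = e1 ` {..<h} \<union> e2 ` {..<h}"
  define u where "u y = (if y \<in> H then w y else y)" for y
  have H1: "e1 i \<in> H \<longleftrightarrow> i < h" and H2: "e2 i \<in> H \<longleftrightarrow> i < h" if "i < m" for i
    unfolding H_def using that mh e1_eq e2_eq ne by (auto simp: image_iff) (metis ne)+
  have u1: "u (e1 i) = (if i < h then e2 i else e1 i)" and u2: "u (e2 i) = (if i < h then e1 i else e2 i)"
    if "i < m" for i
    unfolding u_def using H1[OF that] H2[OF that] w_e1 w_e2 by auto
  have u_out: "u y = y" if "y \<notin> ?Y" for y unfolding u_def using w_out[OF that] by simp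
  have uu: "u \<circ> u = id"
  proof
    fix y show "(u \<circ> u) y = id y" by (rule cases[of y]) (auto simp: u1 u2 u_out)
  qed
  have uperm: "u permutes ?Y" using uu u_out by (rule involution_permutes)
  have hm: "i < m" if "i < h" for i using that mh by simp
  have wrap: "e1 (i + h + h) = e1 i" for i using e1_eq mh by (simp add: add.assoc)
  have tu3: "(t \<circ> u) ^^ 3 = id"
  proof
    fix y
    have e: "((t \<circ> u) ^^ 3) y = t (u (t (u (t (u y)))))" by (simp add: numeral_3_eq_3)
    have v1: "t (u (e1 i)) = e2 i" and v2: "t (u (e2 i)) = e1 (i + h)" and v3: "t (u (e1 (i + h))) = e1 i"
      and v4: "t (u (e2 (i + h))) = e2 (i + h)" if "i < h" for i
      using that hm[OF that] u1[of i] u2[of i] u1[of "i + h"] u2[of "i + h"] mh by (auto simp: t_e1 t_e2 wrap)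
    show "((t \<circ> u) ^^ 3) y = id y" unfolding e
    proof (rule cases[of y])
      fix i assume i: "i < m" "y = e1 i"
      show "t (u (t (u (t (u y))))) = id y"
      proof (cases "i < h")
        case True thus ?thesis using i by (simp add: v1 v2 v3)
      next
        case False
        then obtain i' where "i = i' + h" "i' < h" using i mh by (intro that[of "i - h"]) auto
        thus ?thesis using i by (simp add: v1 v2 v3)
      qed
    next
      fix i assume i: "i < m" "y = e2 i"
      show "t (u (t (u (t (u y))))) = id y"
      proof (cases "i < h")
        case True thus ?thesis using i by (simp add: v1 v2 v3)
      next
        case False
        then obtain i' where "i = i' + h" "i' < h" using i mh by (intro that[of "i - h"]) auto
        thus ?thesis using i by (simp add: v4)
      qed
    qed (simp add: t_out u_out)
  qed
  have tune: "t \<circ> u \<noteq> id"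
  proof
    assume "t \<circ> u = id"
    hence "t (u (e1 0)) = e1 0" by (metis comp_apply id_apply)
    hence "e2 0 = e1 0" using u1[of 0] h0 hm by (simp add: t_e2)
    thus False using ne by metis
  qed
  \<comment> \<open>\<open>t\<close> is a product of \<open>h\<close> transpositions. For
    \<open>h = 1\<close> it is odd, but then \<open>?Y\<close> has four points and
    \<open>card S \<ge> 6\<close> leaves two more; otherwise \<open>t\<close> is the square of
    \<open>x ^^ (h div 2)\<close> restricted to \<open>A\<close>.\<close>
  have ev: "evenperm t \<or> card (S - ?Y) \<ge> 2"
  proof (cases "i0 = 0")
    case True
    hence "m = 2" using mh unfolding h_def by simp
    have finAB: "finite A" "finite B" using AS BS fin finite_subset by blast+
    have "card ?Y = 4" using AB m \<open>m = 2\<close> finAB unfolding A_def B_def by (simp add: card_Un_disjoint)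
    moreover have "card (S - ?Y) = card S - card ?Y" using AS BS finAB by (intro card_Diff_subset) auto
    ultimately have "card (S - ?Y) \<ge> 2" using S6 by linarith
    thus ?thesis ..
  next
    case False
    define r where "r = restrict_id (x ^^ (h div 2)) A"
    have "h div 2 + h div 2 = h" unfolding h_def using False by (cases i0) auto
    hence "t = r \<circ> r"
    proof -
      assume hh: "h div 2 + h div 2 = h"
      have "(x ^^ (h div 2)) y \<in> A" if "y \<in> A" for y
        using that cyc_eq[OF xp, of y y1] unfolding A_def by (metis funpow_in_cyc)
      moreover have "(x ^^ h) y = (x ^^ (h div 2)) ((x ^^ (h div 2)) y)" for y
        using hh funpow_add[of "h div 2" "h div 2" x] by simp
      ultimately show ?thesis unfolding t_def r_def by (auto simp: fun_eq_iff restrict_id_def)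
    qed
    moreover have "permutation r"
    proof (rule permutes_permutation[OF _ fin])
      have "x ^^ (h div 2) permutes S" using permutes_funpow[OF x(1)] .
      moreover have "(x ^^ (h div 2)) ` A = A"
        using image_cyc[of "x ^^ (h div 2)" x y1] funpow_comp_commute[of x x "h div 2"] cyc_eq[OF xp funpow_in_cyc]
        unfolding A_def by simp
      ultimately have "r permutes A" unfolding r_def
        by (intro permutes_restrict_id) (metis bij_betw_def permutes_inj_on)
      thus "r permutes S" using AS permutes_subset by blast
    qed
    ultimately show ?thesis using evenperm_comp by blast
  qed
  show ?thesis
  proof (rule even_2_group_pair[OF fin x, of ?Y t w t u])
    show "y \<in> ?Y \<longleftrightarrow> x y \<in> ?Y" for y using Ainv Binv by blast
  qed (use AS BS tperm tt tx wperm ww wx uperm tu3 tune ev in \<open>auto simp: u_def\<close>)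
qed

section \<open>The symmetric and alternating groups\<close>

lemma even_2_group_pair_not_good:
  assumes fin: "finite S" and x: "x permutes S" "x ^^ (2 ^ k) = id" and S6: "card S \<ge> 6"
    and bad: "\<not> good_type 2 x S"
  shows "\<exists>P Q t u. p_perm_group 2 S P \<and> p_perm_group 2 S Q \<and> x \<in> P \<and> x \<in> Q \<and> t \<in> P \<and> u \<in> Q \<and>
    evenperm t \<and> evenperm u \<and> (t \<circ> u) ^^ 3 = id \<and> t \<circ> u \<noteq> id"
proof -
  have xp: "permutation x" using x fin permutes_permutation by blast
  obtain m where m: "ncyc x S m \<ge> 2" "m = 1 \<Longrightarrow> ncyc x S m \<noteq> 2"
    using bad unfolding good_type_def by (metis not_less)
  let ?F = "{A \<in> cyc x ` S. card A = m}"
  show ?thesis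
  proof (cases "m = 1")
    case True
    hence "3 \<le> card ?F" using m unfolding ncyc_def by simp
    then obtain T where T: "T \<subseteq> ?F" "card T = 3" by (rule obtain_subset_with_card_n)
    from T(2) obtain A B C where ABC: "T = {A, B, C}" "A \<noteq> B" "B \<noteq> C" "A \<noteq> C"
      unfolding card_3_iff by blast
    hence "A \<in> ?F" "B \<in> ?F" "C \<in> ?F" using T(1) by blast+
    note ABC = this ABC(2-4)
    then obtain a b c where abc: "a \<in> S" "b \<in> S" "c \<in> S" "A = cyc x a" "B = cyc x b" "C = cyc x c" by blast
    have "x a = a" "x b = b" "x c = c" using ABC abc True card_cyc_eq_1_iff[OF xp] by auto
    thus ?thesis using abc ABC by (intro even_2_group_pair_three_fixed[OF fin x S6, of a b c]) auto
  next
    case False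
    obtain T where T: "T \<subseteq> ?F" "card T = 2"
      using m(1) unfolding ncyc_def by (rule obtain_subset_with_card_n)
    from T(2) obtain A B where AB: "T = {A, B}" "A \<noteq> B" unfolding card_2_iff by blast
    hence "A \<in> ?F" "B \<in> ?F" using T(1) by blast+
    note AB = this AB(2)
    then obtain a b where ab: "a \<in> S" "b \<in> S" "A = cyc x a" "B = cyc x b" by blast
    have "m \<ge> 2" using AB ab card_cyc_pos[OF xp, of a] False by auto
    thus ?thesis using AB ab by (intro even_2_group_pair_two_cycles[OF fin x S6 ab(1,2)]) auto
  qed
qed

text \<open>The lengths are distinct powers of 2 with sum \<open>card S\<close>, hence exactly those
  of the binary expansion.\<close>

lemma card_cycles_distinct:
  assumes fin: "finite S" and x: "x permutes S" "x ^^ (2 ^ k) = id" and lt: "\<And>m. ncyc x S m < 2"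
  shows "card (cyc x ` S) = card (bits (card S))"
proof -
  have xp: "permutation x" using x fin permutes_permutation by blast
  let ?F = "cyc x ` S"
  have inj: "inj_on card ?F"
  proof (rule inj_onI, rule ccontr)
    fix A B assume AB: "A \<in> ?F" "B \<in> ?F" "card A = card B" "A \<noteq> B"
    hence "{A, B} \<subseteq> {C \<in> ?F. card C = card A}" by auto
    hence "card {A, B} \<le> ncyc x S (card A)" unfolding ncyc_def using fin by (intro card_mono) auto
    thus False using AB lt[of "card A"] by simp
  qed
  have pow: "\<exists>j. card A = 2 ^ j" if "A \<in> ?F" for A
    using that card_cyc_prime_power[OF xp two_is_prime_nat x(2)] by blast
  define J where "J = {j. 2 ^ j \<in> card ` ?F}"
  have im: "(\<lambda>j. 2 ^ j) ` J = card ` ?F" 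
  proof
    show "card ` ?F \<subseteq> (\<lambda>j. 2 ^ j) ` J"
    proof
      fix c assume c: "c \<in> card ` ?F"
      then obtain j where j: "c = 2 ^ j" using pow by blast
      thus "c \<in> (\<lambda>j. 2 ^ j) ` J" using c unfolding J_def by blast
    qed
  qed (auto simp: J_def)
  have injp: "inj_on (\<lambda>j. 2 ^ j :: nat) J" by (auto intro: inj_onI)
  have finJ: "finite J" using im injp fin by (metis finite_imageD finite_imageI)
  have "card S = (\<Sum>A\<in>?F. card A)" using sum_card_cyc[OF fin x(1)] by simp
  also have "\<dots> = (\<Sum>c\<in>card ` ?F. c)" using inj by (simp add: sum.reindex)
  also have "\<dots> = (\<Sum>j\<in>J. 2 ^ j)" unfolding im[symmetric] using injp by (simp add: sum.reindex)
  finally have "card (bits (card S)) = card J" using card_bits_sum_powers[OF finJ] by simp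
  also have "\<dots> = card (card ` ?F)" using card_image[OF injp] im by simp
  also have "\<dots> = card ?F" using card_image[OF inj] .
  finally show ?thesis by simp
qed

text \<open>Fixed points are the only cycles of odd length. In particular, two of them force an even
  number of points.\<close>

lemma even_card_iff_ncyc:
  assumes fin: "finite S" and x: "x permutes S" "x ^^ (2 ^ k) = id"
  shows "even (card S) \<longleftrightarrow> even (ncyc x S 1)"
proof -
  have xp: "permutation x" using x fin permutes_permutation by blast
  let ?F = "cyc x ` S"
  have "even (card A) \<longleftrightarrow> card A \<noteq> 1" if A: "A \<in> ?F" for A
  proof -
    obtain j where "card A = 2 ^ j" using A card_cyc_prime_power[OF xp two_is_prime_nat x(2)] by blast
    thus ?thesis by (cases j) auto
  qed
  hence "{A \<in> ?F. odd (card A)} = {A \<in> ?F. card A = 1}" by blast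
  moreover have "even (\<Sum>A\<in>?F. card A) \<longleftrightarrow> even (card {A \<in> ?F. odd (card A)})"
    using fin by (simp add: even_sum_iff)
  ultimately show ?thesis using sum_card_cyc[OF fin x(1)] unfolding ncyc_def by simp
qed

text \<open>Without one of the two fixed points all lengths are distinct, on
  \<open>card S - 1\<close> points.\<close>

lemma card_cycles_two_fixed:
  assumes fin: "finite S" and x: "x permutes S" "x ^^ (2 ^ k) = id"
    and good: "good_type 2 x S" and two: "ncyc x S 1 = 2"
  shows "card (cyc x ` S) = Suc (card (bits (card S - 1)))"
proof -
  have xp: "permutation x" using x fin permutes_permutation by blast
  have "{A \<in> cyc x ` S. card A = 1} \<noteq> {}" using two unfolding ncyc_def by (metis card.empty zero_neq_numeral)
  then obtain a where a: "a \<in> S" "card (cyc x a) = 1" by blast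
  have xa: "x a = a" using a card_cyc_eq_1_iff[OF xp] by simp
  have ca: "cyc x a = {a}" using xa by (rule cyc_fixed)
  let ?T = "S - {a}"
  have xT: "x permutes ?T" using xa by (intro permutes_superset[OF x(1)]) auto
  have notin: "{a} \<notin> cyc x ` ?T"
  proof
    assume "{a} \<in> cyc x ` ?T"
    then obtain y where "y \<in> ?T" "{a} = cyc x y" by blast
    thus False using self_in_cyc[of y x] by auto
  qed
  have "cyc x ` S = insert (cyc x a) (cyc x ` ?T)" using a(1) by blast
  hence im: "cyc x ` S = insert {a} (cyc x ` ?T)" using ca by simp
  have "ncyc x ?T m < 2" for m
  proof (cases "m = 1")
    case True
    have "{A \<in> cyc x ` S. card A = 1} = insert {a} {A \<in> cyc x ` ?T. card A = 1}" using im by auto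
    moreover have "{a} \<notin> {A \<in> cyc x ` ?T. card A = 1}" using notin by blast
    ultimately have "card {A \<in> cyc x ` S. card A = 1} = Suc (card {A \<in> cyc x ` ?T. card A = 1})"
      using fin by simp
    thus ?thesis using two True unfolding ncyc_def by simp
  next
    case False
    have "ncyc x ?T m \<le> ncyc x S m" unfolding ncyc_def using fin by (intro card_mono) auto
    thus ?thesis using good False unfolding good_type_def by (meson le_less_trans)
  qed
  hence "card (cyc x ` ?T) = card (bits (card ?T))"
    using fin by (intro card_cycles_distinct[OF _ xT x(2)]) auto
  thus ?thesis using im notin fin a(1) by simp
qed

lemma distinct_type_exists:
  fixes n p :: nat
  assumes p: "Factorial_Ring.prime p"
  shows "\<exists>x k. x permutes {1..n} \<and> x ^^ (p ^ k) = id \<and> (\<forall>m. ncyc x {1..n} m < p)"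
proof -
  let ?S = "{1..n}"
  obtain ls where ls: "sum_list ls = n" "\<forall>l\<in>set ls. \<exists>j. l = p ^ j" "\<And>m. count (mset ls) m < p"
    using prime_power_partition[OF p] by blast
  have "l > 0" if "l \<in> set ls" for l using ls(2) that prime_gt_0_nat[OF p] by fastforce
  then obtain x where x: "x permutes ?S" "image_mset card (mset_set (cyc x ` ?S)) = mset ls"
    using permutation_with_cycle_type[of ?S ls] ls(1) by auto
  have xp: "permutation x" using x permutes_permutation by blast
  have "ncyc x ?S m = count (mset ls) m" for m
    unfolding x(2)[symmetric] ncyc_def count_image_mset'
    by (simp add: eq_commute[of m] cong: conj_cong)
  hence "ncyc x ?S m < p" for m using ls(3) by simp
  \<comment> \<open>The exponent \<open>n\<close> is generous: a cycle of length
    \<open>p ^ j\<close> among \<open>n\<close> points has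
    \<open>j < 2 ^ j \<le> p ^ j \<le> n\<close>.\<close>
  moreover have "(x ^^ (p ^ n)) y = y" for y
  proof (cases "y \<in> ?S")
    case True
    have "card (cyc x y) \<in># image_mset card (mset_set (cyc x ` ?S))" using True by auto
    hence "card (cyc x y) \<in> set ls" unfolding x(2) by simp
    then obtain j where j: "card (cyc x y) = p ^ j" using ls(2) by blast
    have "j < 2 ^ j" by (rule less_exp)
    also have "(2::nat) ^ j \<le> p ^ j" using prime_ge_2_nat[OF p] by (rule power_mono) simp
    also have "\<dots> \<le> card ?S" unfolding j[symmetric] using cyc_subset[OF x(1) True] by (intro card_mono) auto
    finally have "j \<le> n" by simp
    hence "card (cyc x y) dvd p ^ n" unfolding j by (rule le_imp_power_dvd)
    thus ?thesis using funpow_eq_self_iff[OF xp] by simp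
  next
    case False
    thus ?thesis using permutes_not_in[OF permutes_funpow[OF x(1)]] by blast
  qed
  hence "x ^^ (p ^ n) = id" by auto
  ultimately show ?thesis using x(1) by blast
qed

section \<open>Passage to the symmetric and alternating groups on n points\<close>

lemma finite_group_prime_sym_group:
  assumes "Factorial_Ring.prime p"
  shows "finite_group_prime (sym_group n) p"
  unfolding finite_group_prime_def finite_group_prime_axioms_def
  using assms sym_group_is_group finite_permutations[of "{1..n}"] by (auto simp: sym_group_def)

lemma finite_group_prime_alt_group:
  assumes "Factorial_Ring.prime p"
  shows "finite_group_prime (alt_group n) p"
  unfolding finite_group_prime_def finite_group_prime_axioms_def
  using assms alt_group_is_group finite_permutations[of "{1..n}"] by (auto simp: alt_group_def)

lemma pow_sym_group: "x [^]\<^bsub>sym_group n\<^esub> (k::nat) = x ^^ k"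
  by (rule nat_pow_eq_funpow) (simp_all add: sym_group_mult sym_group_one)

lemma pow_alt_group: "x [^]\<^bsub>alt_group n\<^esub> (k::nat) = x ^^ k"
  by (rule nat_pow_eq_funpow) (simp_all add: alt_group_mult alt_group_one)

text \<open>The tower group around \<open>P\<close> is itself a \<open>p\<close>-subgroup, so it
  equals \<open>P\<close> by maximality.\<close>

lemma Sylow_sym_group_tower:
  assumes p: "Factorial_Ring.prime p" and P: "P \<in> Sylow_subgroups (sym_group n) p"
  shows "tower p {1..n} P"
proof -
  interpret finite_group_prime "sym_group n" p using finite_group_prime_sym_group[OF p] .
  have Ps: "subgroup P (sym_group n)" using P unfolding Sylow_subgroups_def by blast
  have "p_perm_group p {1..n} P" unfolding p_perm_group_def
  proof (intro conjI ballI)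
    show "id \<in> P" using subgroup.one_closed[OF Ps] by (simp add: sym_group_one)
    fix g assume g: "g \<in> P"
    show "g permutes {1..n}" using subgroup.subset[OF Ps] g sym_group_carrier by blast
    show "\<exists>k. g ^^ (p ^ k) = id"
      using Sylow_element_p_power[OF P g] by (simp add: pow_sym_group sym_group_one)
    fix h assume "h \<in> P"
    thus "g \<circ> h \<in> P" using subgroup.m_closed[OF Ps g] by (simp add: sym_group_mult)
  qed
  then obtain W where W: "tower p {1..n} W" "P \<subseteq> W" using p_perm_group_in_tower[OF p] by blast
  have Wg: "p_perm_group p {1..n} W" using tower_p_perm_group[OF W(1)] .
  have Ws: "subgroup W (sym_group n)"
    using p_perm_group_permutes[OF Wg] prime_gt_0_nat[OF p]
    by (intro p_perm_group_subgroup[OF is_group _ _ Wg]) (auto simp: sym_group_mult sym_group_one sym_group_carrier)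
  have "\<exists>k. card W = p ^ k"
    using p_perm_group_funpow_id[OF Wg]
    by (intro card_p_subgroup[OF p finite_carrier Ws]) (simp add: pow_sym_group sym_group_one)
  hence "P = W" using Sylow_maximal[OF P Ws _ W(2)] by blast
  thus ?thesis using W(1) by simp
qed

lemma not_redundant_if_good:
  assumes p: "Factorial_Ring.prime p" and x: "x permutes {1..n}" "x ^^ (p ^ k) = id" "good_type p x {1..n}"
  shows "\<not> has_redundant_Sylow (sym_group n) p"
    and "evenperm x \<Longrightarrow> \<not> has_redundant_Sylow (alt_group n) p"
proof -
  interpret finite_group_prime "sym_group n" p using finite_group_prime_sym_group[OF p] .
  have uniq: "P = Q" if "P \<in> Sylow_subgroups (sym_group n) p" "Q \<in> Sylow_subgroups (sym_group n) p" "x \<in> P" "x \<in> Q" for P Q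
    using tower_unique[OF p Sylow_sym_group_tower[OF p that(1)] Sylow_sym_group_tower[OF p that(2)] that(3,4) x(3)] .
  have pow: "x [^]\<^bsub>sym_group n\<^esub> (p ^ k) = \<one>\<^bsub>sym_group n\<^esub>"
    using x(2) by (simp add: pow_sym_group sym_group_one)
  have "x \<in> p_elements (sym_group n) p"
    using pow x(1) by (auto simp: mem_p_elements_iff sym_group_carrier)
  thus "\<not> has_redundant_Sylow (sym_group n) p" using not_redundant_if_unique uniq by blast
  assume "evenperm x"
  hence "x \<in> carrier (alt_group n)" using x(1) by (simp add: alt_group_carrier)
  \<comment> \<open>\<open>alt_group n\<close> is by definition \<open>sym_group n\<close> with a
    smaller carrier.\<close>
  hence "\<not> has_redundant_Sylow (sym_group n\<lparr>carrier := carrier (alt_group n)\<rparr>) p"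
    using subgroup_not_redundant_if_unique[OF alt_group_is_subgroup _ pow] uniq by blast
  thus "\<not> has_redundant_Sylow (alt_group n) p" by (simp add: alt_group_def)
qed

lemma evenperm_funpow:
  assumes "permutation x"
  shows "evenperm (x ^^ m) \<longleftrightarrow> even m \<or> evenperm x"
proof (induction m)
  case (Suc m)
  have "evenperm (x \<circ> x ^^ m) \<longleftrightarrow> evenperm x = evenperm (x ^^ m)"
    using assms permutation_funpow by (intro evenperm_comp) auto
  thus ?case using Suc by (metis even_Suc funpow.simps(2))
qed simp

text \<open>The even members of the two 2-groups from \<open>even_2_group_pair_not_good\<close>
  extend to Sylow subgroups containing \<open>x\<close>. If these were equal, the element
  \<open>t \<circ> u\<close> of order 3 would lie in a 2-group.\<close>

lemma alt_group_redundant_2: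
  assumes n: "n \<ge> 6" and bad: "\<And>x k. x permutes {1..n} \<Longrightarrow> x ^^ (2 ^ k) = id \<Longrightarrow> evenperm x \<Longrightarrow> \<not> good_type 2 x {1..n}"
  shows "has_redundant_Sylow (alt_group n) 2"
proof -
  interpret finite_group_prime "alt_group n" 2
    using finite_group_prime_alt_group[OF two_is_prime_nat] .
  have ext: "\<exists>R\<in>Sylow_subgroups (alt_group n) 2. {g \<in> P. evenperm g} \<subseteq> R" if P: "p_perm_group 2 {1..n} P" for P
  proof -
    let ?P = "{g \<in> P. evenperm g}"
    have perm: "permutation g" if "g \<in> P" for g
      using p_perm_group_permutes[OF P that] permutes_permutation by blast
    have "p_perm_group 2 {1..n} ?P" unfolding p_perm_group_def
      using p_perm_group_id[OF P] p_perm_group_comp[OF P] p_perm_group_permutes[OF P]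
        p_perm_group_funpow_id[OF P] perm by (auto simp: evenperm_comp)
    hence Ps: "subgroup ?P (alt_group n)"
      using p_perm_group_permutes[OF P]
      by (intro p_perm_group_subgroup[OF is_group]) (auto simp: alt_group_mult alt_group_one alt_group_carrier)
    have "\<exists>k. card ?P = 2 ^ k"
      using p_perm_group_funpow_id[OF P]
      by (intro card_p_subgroup[OF two_is_prime_nat finite_carrier Ps]) (simp add: pow_alt_group alt_group_one)
    thus ?thesis using p_subgroup_in_Sylow[OF Ps] by blast
  qed
  show ?thesis
  proof (rule redundant_if_not_unique)
    fix x assume "x \<in> p_elements (alt_group n) 2"
    then obtain k where x: "x permutes {1..n}" "evenperm x" "x ^^ (2 ^ k) = id"
      by (auto simp: mem_p_elements_iff alt_group_carrier pow_alt_group alt_group_one)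
    obtain P Q t u where tu: "p_perm_group 2 {1..n} P" "p_perm_group 2 {1..n} Q" "x \<in> P" "x \<in> Q"
      "t \<in> P" "u \<in> Q" "evenperm t" "evenperm u" "(t \<circ> u) ^^ 3 = id" "t \<circ> u \<noteq> id"
      using even_2_group_pair_not_good[OF _ x(1,3) _ bad[OF x(1,3,2)]] n by auto
    obtain R1 where R1: "R1 \<in> Sylow_subgroups (alt_group n) 2" "{g \<in> P. evenperm g} \<subseteq> R1" using ext[OF tu(1)] by blast
    obtain R2 where R2: "R2 \<in> Sylow_subgroups (alt_group n) 2" "{g \<in> Q. evenperm g} \<subseteq> R2" using ext[OF tu(2)] by blast
    have "R1 \<noteq> R2"
    proof
      assume eq: "R1 = R2"
      hence "t \<in> R1" "u \<in> R1" using R1 R2 tu by auto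
      moreover have sub: "subgroup R1 (alt_group n)" using R1(1) unfolding Sylow_subgroups_def by blast
      ultimately have tuR: "t \<circ> u \<in> R1" using subgroup.m_closed[OF sub] by (simp add: alt_group_mult)
      obtain j where j: "(t \<circ> u) ^^ (2 ^ j) = id"
        using Sylow_element_p_power[OF R1(1) tuR] by (auto simp: pow_alt_group alt_group_one)
      have perm: "permutation (t \<circ> u)"
        using subgroup.subset[OF sub] tuR alt_group_carrier' by blast
      have "(t \<circ> u) y = y" for y
      proof -
        have "card (cyc (t \<circ> u) y) dvd 3" "card (cyc (t \<circ> u) y) dvd 2 ^ j"
          using funpow_eq_self_iff[OF perm] tu(9) j by (metis id_apply)+
        moreover have "coprime (3::nat) (2 ^ j)" by simp
        ultimately have "card (cyc (t \<circ> u) y) = 1" by (metis coprime_common_divisor_nat nat_dvd_1_iff_1)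
        thus ?thesis using card_cyc_eq_1_iff[OF perm] by blast
      qed
      thus False using tu(10) by (metis eq_id_iff)
    qed
    thus "\<exists>P\<in>Sylow_subgroups (alt_group n) 2. \<exists>Q\<in>Sylow_subgroups (alt_group n) 2. x \<in> P \<and> x \<in> Q \<and> P \<noteq> Q"
      using R1 R2 tu(3,4) x(2) by blast
  qed
qed

text \<open>A good type has distinct lengths or two fixed points; in both cases the number of cycles
  is known, and the condition would make the permutation odd.\<close>

lemma not_good_if_cond:
  assumes n: "n > 0" and cond: "alt_redundant_cond n"
    and x: "x permutes {1..n}" "x ^^ (2 ^ k) = id" "evenperm x"
  shows "\<not> good_type 2 x {1..n}"
proof
  assume good: "good_type 2 x {1..n}"
  have ev: "even (n + card (cyc x ` {1..n}))" using evenperm_iff_card_cyc[OF _ x(1)] x(3) by simp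
  have odd: "odd (n + card (bits n))" and low: "even n \<Longrightarrow> even (bin_low n)"
    using cond alt_redundant_cond_iff[OF n] by auto
  show False
  proof (cases "ncyc x {1..n} 1 = 2")
    case True
    have "even n" using even_card_iff_ncyc[OF _ x(1,2)] True by simp
    moreover have "card (cyc x ` {1..n}) = Suc (card (bits (n - 1)))"
      using card_cycles_two_fixed[OF _ x(1,2) good True] by simp
    ultimately have "card (cyc x ` {1..n}) = card (bits n) + bin_low n"
      using card_bits_pred[OF n] by simp
    thus False using ev odd low \<open>even n\<close> by simp
  next
    case False
    hence "\<And>m. ncyc x {1..n} m < 2" using good unfolding good_type_def by blast
    hence "card (cyc x ` {1..n}) = card (bits n)" using card_cycles_distinct[OF _ x(1,2)] by simp
    thus False using ev odd by simp
  qed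
qed

text \<open>If \<open>n + card (bits n)\<close> is even, the binary expansion of \<open>n\<close>
  gives an even permutation. Otherwise \<open>n\<close> is even and \<open>bin_low n\<close> odd,
  and the expansion of \<open>n - 1\<close> together with the extra fixed point \<open>n\<close>
  does.\<close>

lemma good_exists_if_not_cond:
  assumes n: "n > 0" and cond: "\<not> alt_redundant_cond n"
  shows "\<exists>x k. x permutes {1..n} \<and> x ^^ (2 ^ k) = id \<and> evenperm x \<and> good_type 2 x {1..n}"
proof (cases "even (n + card (bits n))")
  case True
  obtain x k where x: "x permutes {1..n}" "x ^^ (2 ^ k) = id" "\<And>m. ncyc x {1..n} m < 2"
    using distinct_type_exists[OF two_is_prime_nat] by blast
  have "card (cyc x ` {1..n}) = card (bits n)" using card_cycles_distinct[OF _ x] by simp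
  hence "evenperm x" using evenperm_iff_card_cyc[OF _ x(1)] True by simp
  thus ?thesis using x unfolding good_type_def by blast
next
  case False
  hence even: "even n" and low: "odd (bin_low n)" using cond alt_redundant_cond_iff[OF n] by auto
  obtain x k where x: "x permutes {1..n - 1}" "x ^^ (2 ^ k) = id" "\<And>m. ncyc x {1..n - 1} m < 2"
    using distinct_type_exists[OF two_is_prime_nat] by blast
  have "card (cyc x ` {1..n - 1}) = card (bits (n - 1))" using card_cycles_distinct[OF _ x] by simp
  hence "evenperm x \<longleftrightarrow> even (n - 1 + card (bits (n - 1)))" using evenperm_iff_card_cyc[OF _ x(1)] by simp
  moreover have "n - 1 + card (bits (n - 1)) + 2 = n + card (bits n) + bin_low n"
    using card_bits_pred[OF n even] n by simp
  ultimately have "evenperm x" using False low by presburger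
  have S: "{1..n} = insert n {1..n - 1}" using n by auto
  have xn: "cyc x n = {n}" using n by (intro cyc_fixed permutes_not_in[OF x(1)]) simp
  have "ncyc x {1..n} m < 2 \<or> (m = 1 \<and> ncyc x {1..n} m = 2)" for m
  proof (cases "m = 1")
    case True
    have "{A \<in> cyc x ` {1..n}. card A = m} \<subseteq> insert {n} {A \<in> cyc x ` {1..n - 1}. card A = m}"
      unfolding S using xn by auto
    hence "ncyc x {1..n} m \<le> card (insert {n} {A \<in> cyc x ` {1..n - 1}. card A = m})"
      unfolding ncyc_def by (intro card_mono) auto
    also have "\<dots> \<le> Suc (ncyc x {1..n - 1} m)" unfolding ncyc_def by (rule card_insert_le_m1) auto
    finally show ?thesis using True x(3)[of m] by linarith
  next
    case False
    have "{A \<in> cyc x ` {1..n}. card A = m} \<subseteq> {A \<in> cyc x ` {1..n - 1}. card A = m}"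
      unfolding S using xn False by auto
    hence "ncyc x {1..n} m \<le> ncyc x {1..n - 1} m" unfolding ncyc_def by (intro card_mono) auto
    thus ?thesis using x(3)[of m] by linarith
  qed
  hence "good_type 2 x {1..n}" unfolding good_type_def by simp
  moreover have "x permutes {1..n}" using x(1) by (rule permutes_subset) auto
  ultimately show ?thesis using x(2) \<open>evenperm x\<close> by blast
qed

theorem theoremB:
  fixes p n :: nat and G :: "(nat \<Rightarrow> nat) monoid"
  assumes "Factorial_Ring.prime p"
    and "n \<ge> max 6 p"
    and "G = alt_group n \<or> G = sym_group n"
  shows "has_redundant_Sylow G p \<longleftrightarrow>
           (p = 2 \<and> G = alt_group n \<and> alt_redundant_cond n)"
proof -
  have n: "n \<ge> 6" "n > 0" using assms(2) by auto
  obtain x k where x: "x permutes {1..n}" "x ^^ (p ^ k) = id" "\<And>m. ncyc x {1..n} m < p"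
    using distinct_type_exists[OF assms(1)] by blast
  have good: "good_type p x {1..n}" using x(3) unfolding good_type_def by blast
  \<comment> \<open>The two possibilities for \<open>G\<close> must exclude each other, since the
    right-hand side has to fail for the symmetric group.\<close>
  have ne: "sym_group n \<noteq> alt_group n"
  proof
    assume eq: "sym_group n = alt_group n"
    have "transpose 1 2 \<in> carrier (sym_group n)"
      unfolding sym_group_carrier using n by (intro permutes_swap_id) auto
    hence "evenperm (transpose 1 (2::nat))" unfolding eq alt_group_carrier by blast
    thus False by (simp add: evenperm_swap)
  qed
  show ?thesis
  proof (cases "G = sym_group n")
    case True
    thus ?thesis using ne not_redundant_if_good(1)[OF assms(1) x(1,2) good] by simp
  next
    case False
    hence G: "G = alt_group n" using assms(3) by blast
    show ?thesis
    proof (cases "p = 2")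
      case False
      \<comment> \<open>An element of odd order is an even permutation.\<close>
      have "odd (p ^ k)" using assms(1) False primes_dvd_imp_eq[OF two_is_prime_nat assms(1)] by auto
      hence "evenperm x"
        using evenperm_funpow[OF permutes_permutation[OF x(1)], of "p ^ k"] x(2) by auto
      thus ?thesis using G False not_redundant_if_good(2)[OF assms(1) x(1,2) good] by simp
    next
      case p2: True
      show ?thesis
      proof (cases "alt_redundant_cond n")
        case True
        have "has_redundant_Sylow (alt_group n) 2"
          using not_good_if_cond[OF n(2) True] by (intro alt_group_redundant_2[OF n(1)]) blast
        thus ?thesis using True G p2 by simp
      next
        case False
        obtain v j where v: "v permutes {1..n}" "v ^^ (2 ^ j) = id" "evenperm v" "good_type 2 v {1..n}"
          using good_exists_if_not_cond[OF n(2) False] by blast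
        hence "\<not> has_redundant_Sylow (alt_group n) 2"
          using not_redundant_if_good(2)[OF two_is_prime_nat] by blast
        thus ?thesis using False G p2 by simp
      qed
    qed
  qed
qed

end
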